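(* Consider the $N$-receiver signature protocol described in the context, with parameters $N,k,\omega,s_0,b_H$, and let $$\Xi(k,n,p):=\sum_{j=k}^{n}\binom nj p^j(1-p)^{n-j},\qquad p_t=\Xi\left(\lfloor k(1-s_0)\rfloor+1,\ k,\ 2^{1-b_H}\right).$$ (i) The protocol is $\varepsilon_{\rm for}$-secure against forgery with $$\varepsilon_{\rm for}=(N-\omega)\,\Xi\left(\lfloor N/2\rfloor,\ N-\omega,\ p_t\right);$$ that is, for every coalition $C\subset\{P_1,\dots,P_N\}$ of (at most $\omega$) malicious receivers, not including the sender, which knows a valid pair $\{Doc,Sig\}$, and every forged pair $\{Doc',Sig'\}$ produced by $C$ with $Doc'\neq Doc$, $$\Pr\left[\exists\,P_i\notin C:\ \mathrm{Ver}_{i,0}(Doc',Sig')=\mathrm{True}\right]\le\varepsilon_{\rm for}.$$ (ii) Moreover, the forgery attack in which a dishonest receiver forges the pair $\{Doc',Sig'\}$ and invokes the majority-vote dispute resolution method $\mathrm{MV}$ for the other parties to accept the pair (i.e. so that $\mathrm{MV}(Doc',Sig')=\mathrm{Valid}$) succeeds with probability $$p_{\rm attack}=\Xi\left(\lfloor N/2\rfloor+1-\omega,\ N-\omega,\ p_{-1}\right),\qquad p_{-1}=\Xi\left(\lfloor N/2\rfloor+1-\omega,\ N-\omega,\ p_t\right).$$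
   Context: **Hash family.** $\mathcal{F}_{\rm ASU}$ is a $2^{1-b_H}$-almost strongly universal$_2$ family of functions from $b_M$-bit strings to $b_H$-bit strings: for $f$ uniformly random in $\mathcal{F}_{\rm ASU}$, $\Pr[f(m)=b]=2^{-b_H}$ for all $m,b$, and $\Pr[f(m_1)=b_1\wedge f(m_2)=b_2]\le 2^{1-b_H}/2^{b_H}$ for all $m_1\neq m_2$ and all $b_1,b_2$. **Parameters.** Sender $P_0$, receivers $P_1,\dots,P_N$; $\omega<(N+1)/2$ is the maximum number of dishonest participants; $d_R=(\omega-1)/N$ is the maximum fraction of dishonest receivers when they collude with the sender; $l_{max}\ge 0$ is the maximum verification level, with $(l_{max}+1)d_R<1/2$; $k$ is a positive integer; thresholds $1/2>s_{-1}>s_0>\dots>s_{l_{max}}>0$ are equally spaced with spacing $\Delta s=s_{l-1}-s_l$ taken maximal, i.e. (in the limit) $\Delta s=1/(2(l_{max}+1))$; $\delta_l=1/2+(l+1)d_R$. **Protocol.** 1. Distribution. (1.1) The sender selects uniformly at random with replacement $N^2k$ functions $f_1,\dots,f_{N^2k}$ from $\mathcal{F}_{\rm ASU}$. (1.2) $P_i$ receives over a secret channel $f_{(i-1)Nk+1},\dots,f_{iNk}$. (1.3) $P_i$ randomly partitions $\{(i-1)Nk+1,\dots,iNk\}$ into $N$ sets $R_{i\to1},\dots,R_{i\to N}$ of size $k$, and sends $R_{i\to j}$ and $F_{i\to j}=\{f_r:r\in R_{i\to j}\}$ to $P_j$ over an authenticated secret channel ($R_{i\to i},F_{i\to i}$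 are kept by $P_i$). 2. Messaging. (2.1) The sender sends $\{Doc,Sig\}$ to a recipient over a public channel, with $Sig=(t_1,\dots,t_{N^2k})$, $t_r=f_r(Doc)$. (2.2) For a pair $\{Doc,Sig\}$, receiver $P_i$ defines $T^{Doc}_{i,j,l}=1$ if $\#\{r\in R_{j\to i}:t_r\ne f_r(Doc)\}<s_lk$ and $T^{Doc}_{i,j,l}=0$ otherwise, and $\mathrm{Ver}_{i,l}(Doc,Sig)=\mathrm{True}$ if $\sum_{j=1}^NT^{Doc}_{i,j,l}>N\delta_l$, $\mathrm{False}$ otherwise. $P_i$ tries levels $l=l_{max},l_{max}-1,\dots,0$ and accepts at the first level returning True; if none does, $P_i$ rejects. (2.3) If $P_i$ accepted, the pair is forwarded to the next participant over an authenticated channel; otherwise $P_i$ sends $\perp$ to all remaining participants. **Dispute resolution.** $\mathrm{MV}(Doc,Sig)=\mathrm{Valid}$ if $|\{i:\mathrm{Ver}_{i,-1}(Doc,Sig)=\mathrm{True}\}|\ge\lfloor N/2\rfloor+1$, and $\mathrm{Invalid}$ otherwise. In the attack of (ii), a coalition of $\omega$ dishonest receivers (sender honest) falsely claims that $\{Doc',Sig'\}$ was verified at level $0$ and invokes $\mathrm{MV}$; all dishonest receivers vote for acceptance and each dishonest receiver's own functions $F_{j\to i}$ yield passed tests at the honest receivers. All secret keys and channels are perfectly secret; adversaries are computationally unbounded.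
   Formalization: In (ii), success probability is p_attack only if the forged tags attain the ASU bound and ⌊k(1-s_{-1})⌋=⌊k(1-s_0)⌋; in general it is at most the same formula with s_{-1} in place of s_0 in p_t, with equality for optimal guesses. The printed equality fails otherwise. *)

theory Defs
  imports "HOL-Probability.Probability" "HOL-Probability.Product_PMF"
begin

type_synonym bits = "bool list"
type_synonym hash = "bits \<Rightarrow> bits"

definition bitstrings :: "nat \<Rightarrow> bits set" where
  "bitstrings n = {xs. length xs = n}"

definition almost_strongly_universal2 :: "real \<Rightarrow> 'a set \<Rightarrow> 'b set \<Rightarrow> ('a \<Rightarrow> 'b) set \<Rightarrow> bool" where
  "almost_strongly_universal2 \<epsilon> X Y F \<longleftrightarrow>
     finite F \<and> F \<noteq> {} \<and> F \<subseteq> X \<rightarrow>\<^sub>E Y \<and>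
     (\<forall>x\<in>X. \<forall>y\<in>Y. measure_pmf.prob (pmf_of_set F) {f. f x = y} = 1 / real (card Y)) \<and>
     (\<forall>x1\<in>X. \<forall>x2\<in>X. x1 \<noteq> x2 \<longrightarrow> (\<forall>y1\<in>Y. \<forall>y2\<in>Y.
        measure_pmf.prob (pmf_of_set F) {f. f x1 = y1 \<and> f x2 = y2} \<le> \<epsilon> / real (card Y)))"

definition Xi :: "nat \<Rightarrow> nat \<Rightarrow> real \<Rightarrow> real" where
  "Xi k n p = (\<Sum>j=k..n. real (n choose j) * p ^ j * (1 - p) ^ (n - j))"


type_synonym signed_doc = "bits \<times> (nat \<Rightarrow> bits)"

text \<open>
  A share is the pair \<open>(R\<^bsub>i\<rightarrow>j\<^esub>, F\<^bsub>i\<rightarrow>j\<^esub>)\<close>, the second component giving for every index in the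
  first one the function announced for it. A table \<open>K\<close> of shares holds at \<open>K j i\<close> the share that
  \<open>P\<^sub>i\<close> has received from \<open>P\<^sub>j\<close>.
\<close>

type_synonym share = "nat set \<times> (nat \<Rightarrow> hash)"
type_synonym shares = "nat \<Rightarrow> nat \<Rightarrow> share"

definition mismatches :: "share \<Rightarrow> signed_doc \<Rightarrow> nat" where
  "mismatches S m = card {r \<in> fst S. snd m r \<noteq> snd S r (fst m)}"

text \<open>Levels are integers, since \<open>-1\<close> is used in dispute resolution.\<close>

definition test :: "nat \<Rightarrow> (int \<Rightarrow> real) \<Rightarrow> shares \<Rightarrow> nat \<Rightarrow> nat \<Rightarrow> int \<Rightarrow> signed_doc \<Rightarrow> nat" where
  "test k s K i j l m = (if real (mismatches (K j i) m) < s l * real k then 1 else 0)"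

definition d_R :: "nat \<Rightarrow> nat \<Rightarrow> real" where
  "d_R N \<omega> = (real \<omega> - 1) / real N"

definition delta :: "nat \<Rightarrow> nat \<Rightarrow> int \<Rightarrow> real" where
  "delta N \<omega> l = 1 / 2 + (of_int l + 1) * d_R N \<omega>"

definition Ver :: "nat \<Rightarrow> nat \<Rightarrow> nat \<Rightarrow> (int \<Rightarrow> real) \<Rightarrow> shares \<Rightarrow> nat \<Rightarrow> int \<Rightarrow> signed_doc \<Rightarrow> bool" where
  "Ver N k \<omega> s K i l m \<longleftrightarrow> real (\<Sum>j=1..N. test k s K i j l m) > real N * delta N \<omega> l"

definition MV :: "nat \<Rightarrow> (nat \<Rightarrow> bool) \<Rightarrow> bool" where
  "MV N vote \<longleftrightarrow> card {i \<in> {1..N}. vote i} \<ge> N div 2 + 1"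

text \<open>Honest receivers vote with their level \<open>-1\<close> verdict, members of \<open>C\<close> vote for acceptance.\<close>

definition vote :: "nat \<Rightarrow> nat \<Rightarrow> nat \<Rightarrow> (int \<Rightarrow> real) \<Rightarrow> nat set \<Rightarrow> shares \<Rightarrow> signed_doc \<Rightarrow> nat \<Rightarrow> bool" where
  "vote N k \<omega> s C K m i \<longleftrightarrow> i \<in> C \<or> Ver N k \<omega> s K i (-1) m"


definition block :: "nat \<Rightarrow> nat \<Rightarrow> nat \<Rightarrow> nat set" where
  "block N k i = {(i - 1) * N * k + 1..i * N * k}"

definition partitions :: "nat \<Rightarrow> nat \<Rightarrow> nat \<Rightarrow> (nat \<Rightarrow> nat set) set" where
  "partitions N k i = {R \<in> {1..N} \<rightarrow>\<^sub>E Pow (block N k i).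
     (\<forall>j\<in>{1..N}. card (R j) = k) \<and> disjoint_family_on R {1..N} \<and> (\<Union>j\<in>{1..N}. R j) = block N k i}"

definition share_of :: "(nat \<Rightarrow> hash) \<Rightarrow> nat set \<Rightarrow> share" where
  "share_of f R = (R, restrict f R)"


text \<open>
  What a coalition holds after distribution: the functions its members got from the sender and the
  shares (at \<open>j c\<close>) its members \<open>c\<close> got from honest receivers \<open>j\<close>.
\<close>

type_synonym view = "(nat \<Rightarrow> hash) \<times> shares"

definition view_of :: "nat \<Rightarrow> nat \<Rightarrow> nat set \<Rightarrow> (nat \<Rightarrow> hash) \<Rightarrow> (nat \<Rightarrow> nat \<Rightarrow> nat set) \<Rightarrow> view" where
  "view_of N k C f P =
     (restrict f (\<Union>c\<in>C. block N k c), \<lambda>j\<in>{1..N} - C. \<lambda>c\<in>C. share_of f (P j c))"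

text \<open>
  A computationally unbounded randomized coalition is a family of arbitrary functions of its view
  and of coins tossed in advance. \<open>deal \<rho> v c i\<close> is the share sent by \<open>c \<in> C\<close> to the honest
  receiver \<open>i\<close>, on which no condition is imposed; \<open>request\<close> is the document whose valid signature
  the coalition gets to know, so that a document fixed beforehand is the case of a constant
  function; \<open>forge\<close> maps that valid pair to the forged one.
\<close>

record 'r coalition =
  coins :: "'r pmf"
  deal :: "'r \<Rightarrow> view \<Rightarrow> nat \<Rightarrow> nat \<Rightarrow> share"
  request :: "'r \<Rightarrow> view \<Rightarrow> bits"
  forge :: "'r \<Rightarrow> view \<Rightarrow> signed_doc \<Rightarrow> signed_doc"

definition forger :: "nat \<Rightarrow> 'r coalition \<Rightarrow> bool" where
  "forger b\<^sub>M A \<longleftrightarrow> (\<forall>\<rho> v. request A \<rho> v \<in> bitstrings b\<^sub>M \<and>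
     (\<forall>m. fst m = request A \<rho> v \<longrightarrow>
        fst (forge A \<rho> v m) \<in> bitstrings b\<^sub>M \<and> fst (forge A \<rho> v m) \<noteq> fst m))"

text \<open>
  One run of the protocol with honest sender and malicious receivers \<open>C\<close>. The outcome consists of
  the shares as received, the valid pair and the forged pair.
\<close>

definition run ::
  "nat \<Rightarrow> nat \<Rightarrow> hash set \<Rightarrow> nat set \<Rightarrow> 'r coalition \<Rightarrow> (shares \<times> signed_doc \<times> signed_doc) pmf" where
  "run N k F C A = do {
     f \<leftarrow> Pi_pmf {1..N\<^sup>2 * k} undefined (\<lambda>_. pmf_of_set F);
     P \<leftarrow> Pi_pmf ({1..N} - C) undefined (\<lambda>i. pmf_of_set (partitions N k i));
     \<rho> \<leftarrow> coins A;
     let v = view_of N k C f P;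
     let K = (\<lambda>j i. if j \<in> C then deal A \<rho> v j i else share_of f (P j i));
     let doc = request A \<rho> v;
     let m = (doc, \<lambda>r\<in>{1..N\<^sup>2 * k}. f r doc);
     return_pmf (K, m, forge A \<rho> v m)
   }"

definition own_tests_pass ::
  "nat \<Rightarrow> nat \<Rightarrow> (int \<Rightarrow> real) \<Rightarrow> hash set \<Rightarrow> nat set \<Rightarrow> 'r coalition \<Rightarrow> bool" where
  "own_tests_pass N k s F C A \<longleftrightarrow> (\<forall>(K, m, m') \<in> set_pmf (run N k F C A).
     \<forall>i\<in>{1..N} - C. \<forall>j\<in>C. test k s K i j (-1) m' = 1)"

text \<open>
  The forged tags attain the bound of a \<open>2\<^bsup>1-b\<^sub>H\<^esup>\<close>-almost strongly universal family for all
  functions unknown to the coalition. Only then is the probability of guessing a tag determined by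
  the parameters; in general almost strong universality merely bounds it from above.
\<close>

definition optimal_guesses :: "nat \<Rightarrow> nat \<Rightarrow> nat \<Rightarrow> hash set \<Rightarrow> nat set \<Rightarrow> 'r coalition \<Rightarrow> bool" where
  "optimal_guesses N k b\<^sub>H F C A \<longleftrightarrow> (\<forall>(K, m, m') \<in> set_pmf (run N k F C A).
     \<forall>i\<in>{1..N} - C. \<forall>j\<in>{1..N} - C. \<forall>r \<in> fst (K j i).
       measure_pmf.prob (pmf_of_set F) {h. h (fst m) = snd m r \<and> h (fst m') = snd m' r}
         = 2 powi (1 - int b\<^sub>H) / 2 ^ b\<^sub>H)"

text \<open>Two documents for which every tag of the first admits an optimal guess for the second.\<close>

definition bound_attained :: "nat \<Rightarrow> hash set \<Rightarrow> bits \<Rightarrow> bits \<Rightarrow> bool" where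
  "bound_attained b\<^sub>H F d d' \<longleftrightarrow> (\<forall>t\<in>bitstrings b\<^sub>H. \<exists>t'\<in>bitstrings b\<^sub>H.
     measure_pmf.prob (pmf_of_set F) {h. h d = t \<and> h d' = t'} = 2 powi (1 - int b\<^sub>H) / 2 ^ b\<^sub>H)"

end

(*
  Condition on the partitions, on the coins, on all functions known to the coalition and on all tags
  of the valid document. Then the forged pair is fixed, while the functions exchanged among honest
  receivers are still independent, and each of them maps the forged document to its forged tag with
  conditional probability at most p = 2^(1-b_H). Verification and voting are monotone in these
  successes, so the worst case are independent successes with probability exactly p, for which
  thresholds of counts over disjoint blocks are independent Bernoulli variables again: first the
  tests T_{i,j}, then the verdicts of the receivers.

  In (i) a coalition smaller than omega leaves more than N - omega honest receivers, so the union
  bound alone does not give the claim. It does because each further honest receiver also raises the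
  number of honest tests required, and (n+1) Xi(a+1,n+1,x) <= n Xi(a,n,x) for x <= 1/2 and n <= 2a.
*)

theory Submission
  imports Defs
begin

section \<open>Products of Bernoulli variables\<close>

text \<open>The forged pair depends on the signature, hence on the very functions it is tested
  against, but only through their tags of the signed document; this is why tags, not functions, are
  fixed. One comparison for an arbitrary monotone event of the table of honest tests serves both
  parts, and with guesses that attain the bound the same computation turns the inequality into an
  equality. Shares sent by the coalition are arbitrary, so in upper bounds their tests count as
  passed. The level 0 threshold N/2 + omega - 1 then still requires floor(N/2) + (omega - |C|) tests
  from honest senders of shares. The condition x <= 1/2, needed for x = p_t, comes from a symmetry:
  s_0 < 1/2 asks for more than half of k guesses, each successful with probability at most 1/2. It
  is missing only for b_H = 1, where p_t = 1 and the claimed bound is at least 1.\<close>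

lemma prob_pmf_mono:
  assumes "\<And>x. x \<in> set_pmf M \<Longrightarrow> x \<in> S \<Longrightarrow> x \<in> T"
  shows "measure_pmf.prob M S \<le> measure_pmf.prob M T"
  using assms by (intro measure_pmf.finite_measure_mono_AE) (auto simp: AE_measure_pmf_iff)

lemma prob_pmf_cong:
  assumes "\<And>x. x \<in> set_pmf M \<Longrightarrow> x \<in> S \<longleftrightarrow> x \<in> T"
  shows "measure_pmf.prob M S = measure_pmf.prob M T"
  using assms by (intro antisym prob_pmf_mono) auto

lemma prob_bind_pmf_mono:
  assumes "\<And>x. x \<in> set_pmf M \<Longrightarrow> measure_pmf.prob (f x) S \<le> measure_pmf.prob (g x) T"
  shows "measure_pmf.prob (bind_pmf M f) S \<le> measure_pmf.prob (bind_pmf M g) T"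
proof -
  have "emeasure (bind_pmf M f) S \<le> emeasure (bind_pmf M g) T"
    using assms
    unfolding emeasure_bind_pmf measure_pmf.emeasure_eq_measure[of "f _"] measure_pmf.emeasure_eq_measure[of "g _"]
    by (intro nn_integral_mono_AE) (auto simp: AE_measure_pmf_iff intro: ennreal_leI)
  thus ?thesis
    unfolding measure_pmf.emeasure_eq_measure by (simp only: ennreal_le_iff measure_nonneg)
qed

text \<open>The bound is written as the probability of an event, so that this is the case of a
  constant second kernel. In the applications it is an ideal experiment with independent coin
  tosses, the same for every value conditioned on.\<close>

lemma prob_bind_pmf_le:
  assumes "\<And>x. x \<in> set_pmf M \<Longrightarrow> measure_pmf.prob (f x) S \<le> measure_pmf.prob N T"
  shows "measure_pmf.prob (bind_pmf M f) S \<le> measure_pmf.prob N T"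
  using prob_bind_pmf_mono[of M f S "\<lambda>_. N" T] assms by simp

lemma prob_bind_pmf_eq:
  assumes "\<And>x. x \<in> set_pmf M \<Longrightarrow> measure_pmf.prob (f x) S = measure_pmf.prob N T"
  shows "measure_pmf.prob (bind_pmf M f) S = measure_pmf.prob N T"
  using prob_bind_pmf_mono[of M f S "\<lambda>_. N" T] prob_bind_pmf_mono[of M "\<lambda>_. N" T f S] assms
  by (intro antisym) simp_all

lemma prob_cond_pmf:
  assumes "set_pmf p \<inter> s \<noteq> {}"
  shows "measure_pmf.prob (cond_pmf p s) A = measure_pmf.prob p (s \<inter> A) / measure_pmf.prob p s"
  unfolding cond_pmf.rep_eq[OF assms]
  using emeasure_measure_pmf_not_zero[OF assms]
  by (intro measure_uniform_measure) auto

lemma map_pmf_mem_bernoulli: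
  "map_pmf (\<lambda>x. x \<in> S) M = bernoulli_pmf (measure_pmf.prob M S)"
proof (rule pmf_eqI)
  fix b
  have "(\<lambda>x. x \<in> S) -` {True} = S" "(\<lambda>x. x \<in> S) -` {False} = - S" by auto
  moreover have "measure_pmf.prob M (- S) = 1 - measure_pmf.prob M S"
    using measure_pmf.prob_compl[of S M] by (simp add: Compl_eq_Diff_UNIV)
  ultimately show "pmf (map_pmf (\<lambda>x. x \<in> S) M) b = pmf (bernoulli_pmf (measure_pmf.prob M S)) b"
    by (cases b) (simp_all add: pmf_map)
qed

text \<open>Maps acting on each coordinate separately preserve independence. The conjunct
  \<open>r \<in> A\<close> supplies the default value \<open>False\<close> of the product on the
  right.\<close>

lemma Pi_pmf_mem_bernoulli:
  assumes "finite A"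
  shows "map_pmf (\<lambda>f r. r \<in> A \<and> f r \<in> S r) (Pi_pmf A d Q)
           = Pi_pmf A False (\<lambda>r. bernoulli_pmf (measure_pmf.prob (Q r) (S r)))"
proof -
  have "Pi_pmf A False (\<lambda>r. bernoulli_pmf (measure_pmf.prob (Q r) (S r)))
      = Pi_pmf A False (\<lambda>r. bind_pmf (Q r) (\<lambda>x. return_pmf (x \<in> S r)))"
    unfolding map_pmf_mem_bernoulli[symmetric] map_pmf_def ..
  also have "\<dots> = bind_pmf (Pi_pmf A d Q) (\<lambda>f. Pi_pmf A False (\<lambda>r. return_pmf (f r \<in> S r)))"
    by (rule Pi_pmf_bind[OF assms])
  also have "\<dots> = map_pmf (\<lambda>f r. r \<in> A \<and> f r \<in> S r) (Pi_pmf A d Q)"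
    unfolding map_pmf_def Pi_pmf_return_pmf[OF assms]
    by (intro bind_pmf_cong refl arg_cong[where f=return_pmf] ext) auto
  finally show ?thesis ..
qed

text \<open>Success indicators with the smaller probabilities arise by thinning those with the larger ones.\<close>

lemma prob_Pi_bernoulli_mono:
  assumes "finite A" and q: "\<And>r. r \<in> A \<Longrightarrow> 0 \<le> q r \<and> q r \<le> p r \<and> p r \<le> 1"
    and E: "mono E"
  shows "measure_pmf.prob (Pi_pmf A False (\<lambda>r. bernoulli_pmf (q r))) {M. E M}
           \<le> measure_pmf.prob (Pi_pmf A False (\<lambda>r. bernoulli_pmf (p r))) {M. E M}"
proof -
  define thin where "thin r b = (if b then bernoulli_pmf (q r / p r) else return_pmf False)" for r b
  have thin: "bernoulli_pmf (q r) = bind_pmf (bernoulli_pmf (p r)) (thin r)" if "r \<in> A" for r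
  proof (rule pmf_eqI)
    fix b
    \<comment> \<open>If \<open>p r = 0\<close>, then also \<open>q r = 0\<close>, and the
      convention \<open>0 / 0 = 0\<close> keeps the ratio a probability.\<close>
    have "0 \<le> q r / p r" "q r / p r \<le> 1" "0 \<le> q r" "q r \<le> 1" "0 \<le> p r" "p r \<le> 1"
      and "p r * (q r / p r) = q r"
      using q[OF that] by (auto simp: divide_le_eq_1)
    thus "pmf (bernoulli_pmf (q r)) b = pmf (bind_pmf (bernoulli_pmf (p r)) (thin r)) b"
      by (cases b) (auto simp: pmf_bind thin_def algebra_simps)
  qed
  have "Pi_pmf A False (\<lambda>r. bernoulli_pmf (q r))
      = Pi_pmf A False (\<lambda>r. bind_pmf (bernoulli_pmf (p r)) (thin r))"
    using thin by (intro Pi_pmf_cong) auto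
  also have "\<dots> = bind_pmf (Pi_pmf A False (\<lambda>r. bernoulli_pmf (p r))) (\<lambda>M. Pi_pmf A False (\<lambda>r. thin r (M r)))"
    by (rule Pi_pmf_bind[OF assms(1)])
  finally have "measure_pmf.prob (Pi_pmf A False (\<lambda>r. bernoulli_pmf (q r))) {M. E M}
    = measure_pmf.prob (bind_pmf (Pi_pmf A False (\<lambda>r. bernoulli_pmf (p r))) (\<lambda>M. Pi_pmf A False (\<lambda>r. thin r (M r)))) {M. E M}"
    by simp
  also have "\<dots> \<le> measure_pmf.prob (bind_pmf (Pi_pmf A False (\<lambda>r. bernoulli_pmf (p r))) return_pmf) {M. E M}"
  proof (rule prob_bind_pmf_mono)
    fix M
    \<comment> \<open>Thinning only removes successes, so \<open>M' \<le> M\<close>, and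
      monotonicity carries the event back to \<open>M\<close>.\<close>
    have "E M" if "M' \<in> set_pmf (Pi_pmf A False (\<lambda>r. thin r (M r)))" "E M'" for M'
    proof -
      have "M r" if "M' r" for r
      proof (rule ccontr)
        assume "\<not> M r"
        have "M' \<in> PiE_dflt A False (\<lambda>r. set_pmf (thin r (M r)))"
          using \<open>M' \<in> set_pmf _\<close> \<open>finite A\<close> by (simp add: set_Pi_pmf o_def)
        moreover have "r \<in> A" using calculation \<open>M' r\<close> unfolding PiE_dflt_def by blast
        ultimately have "M' r \<in> set_pmf (thin r (M r))" by (simp add: PiE_dflt_def)
        thus False using \<open>\<not> M r\<close> \<open>M' r\<close> by (simp add: thin_def)
      qed
      hence "M' \<le> M" by (simp add: le_fun_def)
      thus ?thesis using monoD[OF E] that(2) by auto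
    qed
    hence "measure_pmf.prob (Pi_pmf A False (\<lambda>r. thin r (M r))) {M. E M}
        \<le> measure_pmf.prob (Pi_pmf A False (\<lambda>r. thin r (M r))) (if E M then UNIV else {})"
      by (intro prob_pmf_mono) auto
    thus "measure_pmf.prob (Pi_pmf A False (\<lambda>r. thin r (M r))) {M. E M} \<le> measure_pmf.prob (return_pmf M) {M. E M}"
      by (cases "E M") simp_all
  qed
  finally show ?thesis by (simp add: bind_return_pmf')
qed

section \<open>Binomial tails as counts of independent Bernoulli variables\<close>

lemma Xi_eq_prob_binomial:
  assumes "p \<in> {0..1}"
  shows "Xi m n p = measure_pmf.prob (binomial_pmf n p) {m..}"
proof -
  have "measure_pmf.prob (binomial_pmf n p) {m..} = measure_pmf.prob (binomial_pmf n p) {m..n}"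
    using assms by (intro prob_pmf_cong) (auto simp: set_pmf_binomial_eq split: if_splits)
  also have "\<dots> = Xi m n p"
    using assms by (simp add: measure_measure_pmf_finite Xi_def)
  finally show ?thesis ..
qed

lemma Xi_in_unit: "p \<in> {0..1} \<Longrightarrow> Xi m n p \<in> {0..1}"
  by (simp add: Xi_eq_prob_binomial)

lemma Xi_antimono: "p \<in> {0..1} \<Longrightarrow> m' \<le> m \<Longrightarrow> Xi m n p \<le> Xi m' n p"
  by (auto simp: Xi_eq_prob_binomial intro!: measure_pmf.finite_measure_mono)

lemma prob_Pi_bernoulli_count:
  assumes "finite A" "p \<in> {0..1}"
  shows "measure_pmf.prob (Pi_pmf A d (\<lambda>_. bernoulli_pmf p)) {M. card {r \<in> A. M r} \<ge> m} = Xi m (card A) p"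
  using assms
  by (simp add: Xi_eq_prob_binomial binomial_pmf_altdef'[OF \<open>finite A\<close> refl, where dflt=d] vimage_def)

lemma mono_card_ge:
  assumes "finite A"
  shows "mono (\<lambda>M. card {r \<in> A. M r} \<ge> m)"
proof (rule monoI)
  fix M M' :: "'a \<Rightarrow> bool" assume "M \<le> M'"
  hence "{r \<in> A. M r} \<subseteq> {r \<in> A. M' r}" by (auto simp: le_fun_def)
  hence "card {r \<in> A. M r} \<le> card {r \<in> A. M' r}" using assms by (intro card_mono) auto
  thus "(card {r \<in> A. M r} \<ge> m) \<le> (card {r \<in> A. M' r} \<ge> m)" by auto
qed

text \<open>A coupling replaces differentiation: the tail is a monotone count event of
  \<open>n\<close> independent coins.\<close>

lemma Xi_mono:
  assumes "0 \<le> p" "p \<le> p'" "p' \<le> 1"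
  shows "Xi m n p \<le> Xi m n p'"
proof -
  have "measure_pmf.prob (Pi_pmf {..<n} False (\<lambda>_. bernoulli_pmf p)) {M. card {r \<in> {..<n}. M r} \<ge> m}
     \<le> measure_pmf.prob (Pi_pmf {..<n} False (\<lambda>_. bernoulli_pmf p')) {M. card {r \<in> {..<n}. M r} \<ge> m}"
    using assms by (intro prob_Pi_bernoulli_mono mono_card_ge) auto
  thus ?thesis using assms by (simp add: prob_Pi_bernoulli_count[of "{..<n}", simplified])
qed

text \<open>Induction on the blocks: the coordinates of one block split off as an independent
  factor. It serves once for the \<open>k\<close> functions behind a single test and once for all
  tests made by a single receiver.\<close>

lemma Pi_bernoulli_block_count:
  assumes "finite I" "\<And>i. i \<in> I \<Longrightarrow> finite (A i)" "\<And>i. i \<in> I \<Longrightarrow> card (A i) = n"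
    and "disjoint_family_on A I" and p: "p \<in> {0..1}"
  shows "map_pmf (\<lambda>M i. i \<in> I \<and> card {r \<in> A i. M r} \<ge> m) (Pi_pmf (\<Union>i\<in>I. A i) False (\<lambda>_. bernoulli_pmf p))
           = Pi_pmf I False (\<lambda>_. bernoulli_pmf (Xi m n p))"
  using assms(1-4)
proof (induction I rule: finite_induct)
  case empty
  then show ?case by simp
next
  case (insert i I)
  let ?B = "\<lambda>_. bernoulli_pmf p"
  let ?U = "\<Union>i\<in>I. A i"
  let ?V = "\<lambda>I M i. i \<in> I \<and> card {r \<in> A i. M r} \<ge> m"
  have disj: "A i \<inter> ?U = {}" and fin: "finite (A i)" "finite ?U"
    using insert by (auto simp: disjoint_family_on_def)
  have IH: "map_pmf (?V I) (Pi_pmf ?U False ?B) = Pi_pmf I False (\<lambda>_. bernoulli_pmf (Xi m n p))"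
    using insert by (intro insert.IH) (auto simp: disjoint_family_on_def)
  have one: "map_pmf (\<lambda>M. card {r \<in> A i. M r} \<ge> m) (Pi_pmf (A i) False ?B) = bernoulli_pmf (Xi m n p)"
    using map_pmf_mem_bernoulli[of "{M. card {r \<in> A i. M r} \<ge> m}" "Pi_pmf (A i) False ?B"]
      prob_Pi_bernoulli_count[OF fin(1) p, of False m] insert.prems(2)[of i] by simp
  \<comment> \<open>By disjointness, gluing \<open>f\<close> on the new block to \<open>g\<close>
    elsewhere leaves the counts of the old blocks unchanged.\<close>
  have eq: "?V (insert i I) (\<lambda>x. if x \<in> A i then f x else g x)
          = (?V I g)(i := card {r \<in> A i. f r} \<ge> m)" for f g
  proof
    fix j
    have *: "{r \<in> A i. if r \<in> A i then f r else g r} = {r \<in> A i. f r}" by auto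
    have **: "{r \<in> A j. if r \<in> A i then f r else g r} = {r \<in> A j. g r}" if "j \<in> I"
      using that disj by auto
    show "?V (insert i I) (\<lambda>x. if x \<in> A i then f x else g x) j
          = ((?V I g)(i := card {r \<in> A i. f r} \<ge> m)) j"
    proof (cases "j = i")
      case True
      thus ?thesis by (simp only: fun_upd_same * insert_iff simp_thms)
    next
      case False
      thus ?thesis by (simp only: fun_upd_other insert_iff simp_thms) (use ** in \<open>simp cong: conj_cong\<close>)
    qed
  qed
  have "map_pmf (?V (insert i I)) (Pi_pmf (\<Union>i\<in>insert i I. A i) False ?B)
      = map_pmf (\<lambda>(f, g). (?V I g)(i := card {r \<in> A i. f r} \<ge> m))
          (pair_pmf (Pi_pmf (A i) False ?B) (Pi_pmf ?U False ?B))"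
    unfolding UN_insert Pi_pmf_union[OF fin disj] map_pmf_comp
    by (intro map_pmf_cong refl) (simp only: case_prod_unfold eq)
  also have "\<dots> = map_pmf (\<lambda>(b, M). M(i := b))
     (pair_pmf (map_pmf (\<lambda>M. card {r \<in> A i. M r} \<ge> m) (Pi_pmf (A i) False ?B)) (map_pmf (?V I) (Pi_pmf ?U False ?B)))"
    unfolding map_pair[symmetric] map_pmf_comp by (simp only: case_prod_unfold fst_conv snd_conv)
  also have "\<dots> = Pi_pmf (insert i I) False (\<lambda>_. bernoulli_pmf (Xi m n p))"
    unfolding IH one Pi_pmf_insert[OF insert.hyps] ..
  finally show ?case .
qed

section \<open>Guessing tags\<close>

text \<open>The law of total probability along \<open>g\<close>; it is applied to the tag of a
  single random function.\<close>

lemma pmf_eq_bind_cond: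
  "M = bind_pmf (map_pmf g M) (\<lambda>y. cond_pmf M {x. g x = y})"
proof -
  have "bind_pmf (map_pmf g M) (\<lambda>y. cond_pmf M {x. y = g x}) = M"
    by (rule bind_cond_pmf_cancel) (auto simp: vimage_def eq_commute)
  thus ?thesis by (simp add: eq_commute)
qed

text \<open>Every tag has probability \<open>1 / card Y\<close>, so conditioning on it multiplies
  joint probabilities by \<open>card Y\<close>. A forger may also announce some \<open>y'\<close>
  outside \<open>Y\<close>; that guess has probability 0, and as no sign of
  \<open>\<epsilon>\<close> is assumed, the bound is \<open>max 0 \<epsilon>\<close>.\<close>

lemma asu_cond_prob:
  assumes asu: "almost_strongly_universal2 \<epsilon> X Y F" and "finite Y" "x \<in> X" "x' \<in> X" "x' \<noteq> x"
    and y: "y \<in> (\<lambda>h. h x) ` F"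
  shows "measure_pmf.prob (cond_pmf (pmf_of_set F) {h. h x = y}) {h. h x' = y'}
           = measure_pmf.prob (pmf_of_set F) {h. h x = y \<and> h x' = y'} * real (card Y)"
    and "measure_pmf.prob (cond_pmf (pmf_of_set F) {h. h x = y}) {h. h x' = y'} \<le> max 0 \<epsilon>"
proof -
  have F: "finite F" "F \<noteq> {}" "F \<subseteq> X \<rightarrow>\<^sub>E Y"
    and F1: "\<And>x y. x \<in> X \<Longrightarrow> y \<in> Y \<Longrightarrow> measure_pmf.prob (pmf_of_set F) {h. h x = y} = 1 / real (card Y)"
    and F2: "\<And>x x' y y'. x \<in> X \<Longrightarrow> x' \<in> X \<Longrightarrow> x \<noteq> x' \<Longrightarrow> y \<in> Y \<Longrightarrow> y' \<in> Y \<Longrightarrow>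
        measure_pmf.prob (pmf_of_set F) {h. h x = y \<and> h x' = y'} \<le> \<epsilon> / real (card Y)"
    using asu by (auto simp: almost_strongly_universal2_def)
  have "y \<in> Y" using y F \<open>x \<in> X\<close> by auto
  hence Y: "card Y > 0" using \<open>finite Y\<close> by (auto simp: card_gt_0_iff)
  have ne: "set_pmf (pmf_of_set F) \<inter> {h. h x = y} \<noteq> {}" using y F by auto
  show eq: "measure_pmf.prob (cond_pmf (pmf_of_set F) {h. h x = y}) {h. h x' = y'}
           = measure_pmf.prob (pmf_of_set F) {h. h x = y \<and> h x' = y'} * real (card Y)"
    using F1[OF \<open>x \<in> X\<close> \<open>y \<in> Y\<close>] by (simp add: prob_cond_pmf[OF ne] Int_def)
  show "measure_pmf.prob (cond_pmf (pmf_of_set F) {h. h x = y}) {h. h x' = y'} \<le> max 0 \<epsilon>"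
  proof (cases "y' \<in> Y")
    case True
    thus ?thesis using F2[of x x' y y'] assms(3-5) \<open>y \<in> Y\<close> Y by (simp add: eq field_simps)
  next
    case False
    have "measure_pmf.prob (pmf_of_set F) {h. h x = y \<and> h x' = y'} \<le> measure_pmf.prob (pmf_of_set F) {}"
      using False F \<open>x' \<in> X\<close> by (intro prob_pmf_mono) auto
    hence "measure_pmf.prob (pmf_of_set F) {h. h x = y \<and> h x' = y'} = 0"
      by (intro antisym measure_nonneg) simp
    thus ?thesis by (simp add: eq)
  qed
qed

text \<open>
  Given the tags of \<open>x\<close>, the functions remain independent, and each maps \<open>x'\<close> to a given tag with
  conditional probability at most \<open>\<epsilon>\<close>.
\<close>

lemma tag_guessing:
  fixes U :: "'i set" and F :: "('x \<Rightarrow> 'y) set" and d :: "'x \<Rightarrow> 'y" and g :: "('i \<Rightarrow> 'y) \<Rightarrow> 'i \<Rightarrow> 'y"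
  assumes asu: "almost_strongly_universal2 \<epsilon> X Y F" and "finite Y" and \<epsilon>: "\<epsilon> \<in> {0..1}"
    and U: "finite U" and x: "x \<in> X" and x': "\<And>t. x' t \<in> X" "\<And>t. x' t \<noteq> x"
    and E: "mono E"
  defines "t \<equiv> \<lambda>f. \<lambda>r\<in>U. f r x"
  defines "success \<equiv> measure_pmf.prob (Pi_pmf U d (\<lambda>_. pmf_of_set F))
                       {f. E (\<lambda>r. r \<in> U \<and> f r (x' (t f)) = g (t f) r)}"
  defines "ideal \<equiv> measure_pmf.prob (Pi_pmf U False (\<lambda>_. bernoulli_pmf \<epsilon>)) {M. E M}"
  shows "success \<le> ideal"
    and "(\<And>f r. f \<in> set_pmf (Pi_pmf U d (\<lambda>_. pmf_of_set F)) \<Longrightarrow> r \<in> U \<Longrightarrow>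
            measure_pmf.prob (pmf_of_set F) {h. h x = f r x \<and> h (x' (t f)) = g (t f) r} = \<epsilon> / real (card Y))
         \<Longrightarrow> success = ideal"
proof -
  have F: "finite F" "F \<noteq> {}" "F \<subseteq> X \<rightarrow>\<^sub>E Y"
    using asu by (auto simp: almost_strongly_universal2_def)
  hence "card Y > 0" using x \<open>finite Y\<close> by (fastforce simp: card_gt_0_iff)
  define Q where "Q y = cond_pmf (pmf_of_set F) {h. h x = y}" for y
  define Tag where "Tag = Pi_pmf U undefined (\<lambda>_. map_pmf (\<lambda>h. h x) (pmf_of_set F))"
  define G where "G \<tau> = Pi_pmf U d (\<lambda>r. Q (\<tau> r))" for \<tau>
  define p where "p \<tau> r = measure_pmf.prob (Q (\<tau> r)) {h. h (x' \<tau>) = g \<tau> r}" for \<tau> r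
  \<comment> \<open>Each function is drawn as a tag followed by a function conditioned on that tag.
    The product commutes with this coordinatewise bind, so the whole tag vector may be drawn
    first.\<close>
  have split: "Pi_pmf U d (\<lambda>_. pmf_of_set F) = bind_pmf Tag G"
    unfolding G_def Tag_def Q_def
    by (subst pmf_eq_bind_cond[of "pmf_of_set F" "\<lambda>h. h x"]) (rule Pi_pmf_bind[OF U])
  have Tag: "\<tau> r \<in> (\<lambda>h. h x) ` F" if "\<tau> \<in> set_pmf Tag" "r \<in> U" for \<tau> r
    using that F U by (auto simp: Tag_def set_Pi_pmf PiE_dflt_def)
  \<comment> \<open>The tag vector is recovered from \<open>f\<close>, also outside
    \<open>U\<close>, where both sides are \<open>undefined\<close>. Hence \<open>x' (t f)\<close>
    and \<open>g (t f)\<close> are constant on the support of \<open>G \<tau>\<close>.\<close>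
  have G: "t f = \<tau>" if "\<tau> \<in> set_pmf Tag" "f \<in> set_pmf (G \<tau>)" for \<tau> f
  proof
    fix r
    show "t f r = \<tau> r"
    proof (cases "r \<in> U")
      case True
      have "f \<in> PiE_dflt U d (\<lambda>r. set_pmf (Q (\<tau> r)))"
        using that(2) U by (simp add: G_def set_Pi_pmf o_def)
      hence "f r \<in> set_pmf (Q (\<tau> r))" using True by (simp add: PiE_dflt_def)
      moreover have "set_pmf (pmf_of_set F) \<inter> {h. h x = \<tau> r} \<noteq> {}" using Tag[OF that(1) True] F by auto
      ultimately show ?thesis using True by (simp add: Q_def t_def)
    next
      case False
      thus ?thesis using that(1) U by (simp add: t_def Tag_def set_Pi_pmf PiE_dflt_def)
    qed
  qed
  have cond: "measure_pmf.prob (G \<tau>) {f. E (\<lambda>r. r \<in> U \<and> f r (x' (t f)) = g (t f) r)}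
      = measure_pmf.prob (Pi_pmf U False (\<lambda>r. bernoulli_pmf (p \<tau> r))) {M. E M}"
    if "\<tau> \<in> set_pmf Tag" for \<tau>
  proof -
    have "measure_pmf.prob (G \<tau>) {f. E (\<lambda>r. r \<in> U \<and> f r (x' (t f)) = g (t f) r)}
        = measure_pmf.prob (G \<tau>) {f. E (\<lambda>r. r \<in> U \<and> f r \<in> {h. h (x' \<tau>) = g \<tau> r})}"
      using G[OF that] by (intro prob_pmf_cong) simp
    also have "\<dots> = measure_pmf.prob (map_pmf (\<lambda>f r. r \<in> U \<and> f r \<in> {h. h (x' \<tau>) = g \<tau> r}) (G \<tau>)) {M. E M}"
      unfolding measure_map_pmf vimage_def by simp
    also have "\<dots> = measure_pmf.prob (Pi_pmf U False (\<lambda>r. bernoulli_pmf (p \<tau> r))) {M. E M}"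
      unfolding G_def p_def Pi_pmf_mem_bernoulli[OF U] ..
    finally show ?thesis .
  qed
  have le: "p \<tau> r \<le> \<epsilon>" if "\<tau> \<in> set_pmf Tag" "r \<in> U" for \<tau> r
    using asu_cond_prob(2)[OF asu \<open>finite Y\<close> x x' Tag[OF that], of \<tau> "g \<tau> r"] \<epsilon>
    by (simp add: p_def Q_def)
  show "success \<le> ideal"
    unfolding success_def split ideal_def
  proof (rule prob_bind_pmf_le)
    fix \<tau> assume "\<tau> \<in> set_pmf Tag"
    thus "measure_pmf.prob (G \<tau>) {f. E (\<lambda>r. r \<in> U \<and> f r (x' (t f)) = g (t f) r)}
       \<le> measure_pmf.prob (Pi_pmf U False (\<lambda>_. bernoulli_pmf \<epsilon>)) {M. E M}"
      unfolding cond[OF \<open>\<tau> \<in> _\<close>] using \<epsilon> le U E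
      by (intro prob_Pi_bernoulli_mono) (auto simp: p_def)
  qed
  assume tight: "\<And>f r. f \<in> set_pmf (Pi_pmf U d (\<lambda>_. pmf_of_set F)) \<Longrightarrow> r \<in> U \<Longrightarrow>
            measure_pmf.prob (pmf_of_set F) {h. h x = f r x \<and> h (x' (t f)) = g (t f) r} = \<epsilon> / real (card Y)"
  show "success = ideal"
    unfolding success_def split ideal_def
  proof (rule prob_bind_pmf_eq)
    fix \<tau> assume \<tau>: "\<tau> \<in> set_pmf Tag"
    have "p \<tau> r = \<epsilon>" if r: "r \<in> U" for r
    proof -
      \<comment> \<open>The hypothesis speaks about functions, but only their tags enter it; any
        \<open>f\<close> in the support of \<open>G \<tau>\<close> represents
        \<open>\<tau>\<close>.\<close>
      obtain f where f: "f \<in> set_pmf (G \<tau>)" using set_pmf_not_empty[of "G \<tau>"] by blast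
      have "f r x = \<tau> r" using fun_cong[OF G[OF \<tau> f], of r] r by (simp add: t_def)
      hence "measure_pmf.prob (pmf_of_set F) {h. h x = \<tau> r \<and> h (x' \<tau>) = g \<tau> r} = \<epsilon> / real (card Y)"
        using tight[of f r] \<tau> f r G[OF \<tau> f] by (auto simp: split)
      thus ?thesis
        using asu_cond_prob(1)[OF asu \<open>finite Y\<close> x x' Tag[OF \<tau> r], of \<tau> "g \<tau> r"] \<open>card Y > 0\<close>
        by (simp add: p_def Q_def)
    qed
    hence "Pi_pmf U False (\<lambda>r. bernoulli_pmf (p \<tau> r)) = Pi_pmf U False (\<lambda>_. bernoulli_pmf \<epsilon>)"
      by (intro Pi_pmf_cong) auto
    thus "measure_pmf.prob (G \<tau>) {f. E (\<lambda>r. r \<in> U \<and> f r (x' (t f)) = g (t f) r)}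
       = measure_pmf.prob (Pi_pmf U False (\<lambda>_. bernoulli_pmf \<epsilon>)) {M. E M}"
      by (simp add: cond[OF \<tau>])
  qed
qed

section \<open>Binomial tails above the mean\<close>

text \<open>
  Above the mean the binomial weights decrease geometrically, so the tail beyond \<open>a\<close> is small
  compared with the weight at \<open>a\<close>.
\<close>

lemma binomial_weight_decreasing:
  fixes p :: real
  assumes p: "0 \<le> p" "p \<le> 1 / 2" and "n \<le> 2 * a" "a < j" "j \<le> n"
  shows "real (n choose j) * p ^ j * (1 - p) ^ (n - j)
           \<le> real (n - a) / real (a + 1) * (real (n choose a) * p ^ a * (1 - p) ^ (n - a))"
  using Suc_leI[OF \<open>a < j\<close>] \<open>j \<le> n\<close>
proof (induction j rule: dec_induct)
  case base
  \<comment> \<open>The factor \<open>(n - a) / (a + 1)\<close> is the ratio of consecutive binomial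
    coefficients; \<open>p \<le> 1 - p\<close> absorbs the change in the powers.\<close>
  have "p * (1 - p) ^ (n - Suc a) \<le> (1 - p) * (1 - p) ^ (n - Suc a)"
    using p by (intro mult_right_mono) auto
  also have "\<dots> = (1 - p) ^ (n - a)" using base by (simp add: Suc_diff_Suc flip: power_Suc)
  finally have *: "p * (1 - p) ^ (n - Suc a) \<le> (1 - p) ^ (n - a)" .
  have ch: "real (n choose Suc a) = real (n - a) / real (a + 1) * real (n choose a)"
  proof -
    have "Suc a * (n choose Suc a) = (n - a) * (n choose a)"
      by (simp only: binomial_absorption binomial_absorb_comp)
    hence "real (Suc a) * real (n choose Suc a) = real (n - a) * real (n choose a)"
      by (metis of_nat_mult)
    thus ?thesis by (simp add: field_simps)
  qed
  have "real (n choose Suc a) * p ^ Suc a * (1 - p) ^ (n - Suc a)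
      = real (n choose Suc a) * p ^ a * (p * (1 - p) ^ (n - Suc a))" by simp
  also have "\<dots> \<le> real (n choose Suc a) * p ^ a * (1 - p) ^ (n - a)"
    using * p by (intro mult_left_mono) auto
  finally show ?case by (simp add: ch)
next
  case (step j)
  have "p * (1 - p) ^ (n - Suc j) \<le> (1 - p) * (1 - p) ^ (n - Suc j)"
    using p by (intro mult_right_mono) auto
  also have "\<dots> = (1 - p) ^ (n - j)" using step by (simp add: Suc_diff_Suc flip: power_Suc)
  finally have *: "p * (1 - p) ^ (n - Suc j) \<le> (1 - p) ^ (n - j)" .
  \<comment> \<open>After the first step it is enough that binomial coefficients do not increase
    past the middle; no further factor is gained.\<close>
  have "n choose Suc j \<le> n choose j"
    using step \<open>n \<le> 2 * a\<close> by (intro binomial_antimono) auto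
  hence "real (n choose Suc j) * p ^ j * (p * (1 - p) ^ (n - Suc j)) \<le> real (n choose j) * p ^ j * (1 - p) ^ (n - j)"
    using * p by (intro mult_mono) auto
  also have "\<dots> \<le> real (n - a) / real (a + 1) * (real (n choose a) * p ^ a * (1 - p) ^ (n - a))"
    using step by simp
  finally show ?case by (simp add: mult_ac)
qed

lemma Xi_eq_0: "n < m \<Longrightarrow> Xi m n p = 0"
  by (simp add: Xi_def)

lemma Xi_eq_weight_plus:
  "m \<le> n \<Longrightarrow> Xi m n p = real (n choose m) * p ^ m * (1 - p) ^ (n - m) + Xi (Suc m) n p"
  unfolding Xi_def by (rule sum.atLeast_Suc_atMost)

text \<open>The last of \<open>n + 1\<close> tosses succeeds or fails; algebraically this is
  Pascal's rule.\<close>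

lemma Xi_Suc_Suc: "Xi (Suc m) (Suc n) p = p * Xi m n p + (1 - p) * Xi (Suc m) n p"
proof -
  have "Xi (Suc m) (Suc n) p = (\<Sum>j=m..n. real (Suc n choose Suc j) * p ^ Suc j * (1 - p) ^ (n - j))"
    unfolding Xi_def by (subst sum.shift_bounds_cl_Suc_ivl) simp
  also have "\<dots> = (\<Sum>j=m..n. p * (real (n choose j) * p ^ j * (1 - p) ^ (n - j)))
       + (\<Sum>j=m..n. real (n choose Suc j) * p ^ Suc j * (1 - p) ^ (n - j))"
    by (simp add: sum.distrib[symmetric] algebra_simps)
  also have "(\<Sum>j=m..n. real (n choose Suc j) * p ^ Suc j * (1 - p) ^ (n - j))
      = (\<Sum>j=Suc m..Suc n. real (n choose j) * p ^ j * (1 - p) ^ (Suc n - j))"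
    by (subst sum.shift_bounds_cl_Suc_ivl) simp
  also have "\<dots> = (\<Sum>j=Suc m..n. real (n choose j) * p ^ j * (1 - p) ^ (Suc n - j))"
    by (rule sum.mono_neutral_right) auto
  also have "\<dots> = (\<Sum>j=Suc m..n. (1 - p) * (real (n choose j) * p ^ j * (1 - p) ^ (n - j)))"
    by (intro sum.cong refl) (auto simp: Suc_diff_le)
  finally show ?thesis by (simp add: Xi_def sum_distrib_left)
qed

text \<open>Let \<open>b\<close> be the weight at \<open>a\<close> and T the tail beyond it. The
  recursion reduces the claim to T <= (n - (n + 1) p) b. The tail has n - a terms, each at most (n -
  a) / (a + 1) times b, and for n >= 2 the total factor is at most (n - 1) / 2 <= n - (n + 1)
  p.\<close>

lemma Suc_mult_Xi_Suc_le:
  assumes p: "0 \<le> p" "p \<le> 1 / 2" and "n \<le> 2 * a" "n \<ge> 1"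
  shows "real (Suc n) * Xi (Suc a) (Suc n) p \<le> real n * Xi a n p"
proof (cases "a \<le> n")
  case False
  thus ?thesis by (simp add: Xi_eq_0)
next
  case True
  define b where "b = real (n choose a) * p ^ a * (1 - p) ^ (n - a)"
  have b: "b \<ge> 0" using p by (simp add: b_def)
  have "real (n - a) * (real (n - a) / real (a + 1)) \<le> (real n - 1) / 2"
  \<comment> \<open>For n = 1 the estimate n^2 <= (n - 1) (n + 2) behind the general case fails, but
    then a = 1 and the tail beyond \<open>a\<close> is empty.\<close>
  proof (cases "n = 1")
    case True
    hence "n - a = 0" using assms \<open>a \<le> n\<close> by auto
    thus ?thesis using True by simp
  next
    case False
    hence n: "real n \<ge> 2" using \<open>n \<ge> 1\<close> by simp
    have "real n \<le> 2 * real a" using \<open>n \<le> 2 * a\<close> by linarith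
    hence "real (n - a) \<le> real n / 2" "real (a + 1) \<ge> (real n + 2) / 2" using True by auto
    hence "real (n - a) * real (n - a) / real (a + 1) \<le> (real n / 2) * (real n / 2) / ((real n + 2) / 2)"
      by (intro frac_le mult_mono) auto
    also have "\<dots> \<le> (real n - 1) / 2"
      using n by (simp add: field_simps)
    finally show ?thesis by simp
  qed
  also have "\<dots> \<le> real n - real (Suc n) * p"
    using mult_left_mono[OF p(2), of "real (Suc n)"] by (simp add: field_simps)
  finally have *: "real (n - a) * (real (n - a) / real (a + 1)) \<le> real n - real (Suc n) * p" .
  have "Xi (Suc a) n p \<le> (\<Sum>j=Suc a..n. real (n - a) / real (a + 1) * b)"
    unfolding Xi_def b_def using assms by (intro sum_mono binomial_weight_decreasing) auto
  also have "\<dots> = real (n - a) * (real (n - a) / real (a + 1)) * b" using True by simp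
  also have "\<dots> \<le> (real n - real (Suc n) * p) * b" using * b by (rule mult_right_mono)
  finally have "Xi (Suc a) n p \<le> (real n - real (Suc n) * p) * b" .
  moreover have "Xi a n p = b + Xi (Suc a) n p" unfolding b_def by (rule Xi_eq_weight_plus[OF True])
  ultimately show ?thesis by (simp add: Xi_Suc_Suc algebra_simps)
qed

text \<open>Here \<open>d\<close> is the number of members by which a coalition falls short of
  \<open>\<omega>\<close>: each of them adds one honest receiver and one required honest
  test.\<close>

lemma mult_Xi_add_le:
  assumes "0 \<le> p" "p \<le> 1 / 2" and "n + d \<le> 2 * a + 1" "n \<ge> 1"
  shows "real (n + d) * Xi (a + d) (n + d) p \<le> real n * Xi a n p"
  using assms(3)
proof (induction d)
  case (Suc d)
  have "real (n + Suc d) * Xi (a + Suc d) (n + Suc d) p \<le> real (n + d) * Xi (a + d) (n + d) p"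
    using Suc_mult_Xi_Suc_le[OF assms(1,2), of "n + d" "a + d"] Suc.prems assms(4) by simp
  also have "\<dots> \<le> real n * Xi a n p" using Suc by simp
  finally show ?case .
qed simp

text \<open>The reflection of j to n - j maps the upper tail injectively below \<open>m\<close> and,
  as \<open>p \<le> 1 / 2\<close>, never lowers a weight. So twice the tail is at most the total
  mass 1.\<close>

lemma Xi_le_half:
  assumes p: "0 \<le> p" "p \<le> 1 / 2" and "n < 2 * m"
  shows "Xi m n p \<le> 1 / 2"
proof -
  define w where "w j = real (n choose j) * p ^ j * (1 - p) ^ (n - j)" for j
  have w: "w j \<ge> 0" for j using p by (simp add: w_def)
  have refl: "w j \<le> w (n - j)" if "j \<in> {m..n}" for j
  proof -
    \<comment> \<open>Both weights share the factor \<open>(p * (1 - p)) ^ (n - j)\<close>; what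
      remains is a power of \<open>p\<close> or of \<open>1 - p\<close> with the surplus exponent
      \<open>2 * j - n\<close>.\<close>
    have j: "j = (n - j) + (2 * j - n)" "n - (n - j) = (n - j) + (2 * j - n)" "j \<le> n" using that assms by auto
    have "p ^ j * (1 - p) ^ (n - j) = (p * (1 - p)) ^ (n - j) * p ^ (2 * j - n)"
      by (subst j(1)) (simp only: power_add power_mult_distrib mult_ac)
    also have "\<dots> \<le> (p * (1 - p)) ^ (n - j) * (1 - p) ^ (2 * j - n)"
      using p by (intro mult_left_mono power_mono) auto
    also have "\<dots> = p ^ (n - j) * (1 - p) ^ (n - (n - j))"
      by (subst j(2)) (simp only: power_add power_mult_distrib mult_ac)
    finally have "real (n choose j) * (p ^ j * (1 - p) ^ (n - j)) \<le> real (n choose j) * (p ^ (n - j) * (1 - p) ^ (n - (n - j)))"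
      by (intro mult_left_mono) auto
    thus ?thesis using binomial_symmetric[OF j(3)] by (simp add: w_def mult_ac)
  qed
  have "Xi m n p = (\<Sum>j=m..n. w j)" by (simp add: Xi_def w_def)
  hence "2 * Xi m n p \<le> (\<Sum>j=m..n. w j) + (\<Sum>j=m..n. w (n - j))"
    using sum_mono[of "{m..n}", OF refl] by simp
  also have "(\<Sum>j=m..n. w (n - j)) = sum w ((\<lambda>j. n - j) ` {m..n})"
    by (subst sum.reindex) (auto simp: inj_on_def)
  also have "(\<Sum>j=m..n. w j) + \<dots> = sum w ({m..n} \<union> (\<lambda>j. n - j) ` {m..n})"
    using assms by (intro sum.union_disjoint[symmetric]) auto
  also have "\<dots> \<le> sum w {..n}" using w by (intro sum_mono2) auto
  also have "\<dots> = (p + (1 - p)) ^ n" unfolding binomial_ring by (simp add: w_def)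
  finally show ?thesis by simp
qed

lemma Xi_1: "m \<le> n \<Longrightarrow> Xi m n 1 = 1"
proof -
  assume "m \<le> n"
  have "Xi m n 1 = (\<Sum>j=m..n. if j = n then 1 else 0)"
    unfolding Xi_def by (intro sum.cong) auto
  thus ?thesis using \<open>m \<le> n\<close> by simp
qed

section \<open>Test tables of a run\<close>

lemma finite_bitstrings: "finite (bitstrings n)"
  and card_bitstrings: "card (bitstrings n) = 2 ^ n"
  using finite_lists_length_eq[of "UNIV :: bool set" n] card_lists_length_eq[of "UNIV :: bool set" n]
  by (simp_all add: bitstrings_def)

lemma card_block: "i \<ge> 1 \<Longrightarrow> card (block N k i) = N * k"
  by (cases i) (simp_all add: block_def algebra_simps)

lemma finite_block: "finite (block N k i)"
  by (simp add: block_def)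

lemma block_subset: "i \<in> {1..N} \<Longrightarrow> block N k i \<subseteq> {1..N\<^sup>2 * k}"
proof -
  assume "i \<in> {1..N}"
  hence "i * (N * k) \<le> N * (N * k)" by (intro mult_right_mono) auto
  thus ?thesis by (auto simp: block_def power2_eq_square mult_ac)
qed

lemma disjoint_blocks:
  assumes "i \<ge> 1" "j \<ge> 1" "i \<noteq> j"
  shows "block N k i \<inter> block N k j = {}"
proof -
  have *: "block N k i \<inter> block N k j = {}" if "i < j" for i j
  proof -
    have "i * N * k \<le> (j - 1) * N * k" using that by (intro mult_right_mono) auto
    thus ?thesis
      unfolding block_def by (intro equals0I) (unfold Int_iff atLeastAtMost_iff, linarith)
  qed
  show ?thesis using *[of i j] *[of j i] assms by (cases "i < j") auto
qed

lemma equipartition_exists: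
  assumes "finite S" "card S = n * k"
  shows "\<exists>R. (\<forall>j\<in>{1..n}. card (R j) = k) \<and> disjoint_family_on R {1..n} \<and> (\<Union>j\<in>{1..n}. R j) = S"
  using assms
proof (induction n arbitrary: S)
  case (Suc n)
  obtain T where T: "T \<subseteq> S" "card T = k" "finite T"
    using obtain_subset_with_card_n[of k S] Suc.prems by auto
  hence "card (S - T) = n * k" using Suc.prems by (simp add: card_Diff_subset)
  then obtain R where R: "\<forall>j\<in>{1..n}. card (R j) = k" "disjoint_family_on R {1..n}" "(\<Union>j\<in>{1..n}. R j) = S - T"
    using Suc.IH[of "S - T"] Suc.prems by auto
  have disj: "R j \<inter> T = {}" if "j \<in> {1..n}" for j using R(3) that by blast
  show ?case
  proof (intro exI[of _ "R(Suc n := T)"] conjI)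
    show "\<forall>j\<in>{1..Suc n}. card ((R(Suc n := T)) j) = k" using R(1) T by (auto simp: le_Suc_eq)
    show "disjoint_family_on (R(Suc n := T)) {1..Suc n}"
    proof -
      have "disjoint_family_on (R(Suc n := T)) {1..n}"
        using R(2) by (simp add: disjoint_family_on_def)
      moreover have "T \<inter> (\<Union>j\<in>{1..n}. (R(Suc n := T)) j) = {}"
        using disj by fastforce
      ultimately show ?thesis
        by (simp add: atLeastAtMostSuc_conv disjoint_family_on_insert)
    qed
    have "(\<Union>j\<in>{1..Suc n}. (R(Suc n := T)) j) = (\<Union>j\<in>{1..n}. R j) \<union> T"
      by (auto simp: le_Suc_eq)
    thus "(\<Union>j\<in>{1..Suc n}. (R(Suc n := T)) j) = S" using T(1) by (simp only: R(3)) auto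
  qed
qed (auto simp: disjoint_family_on_def)

lemma finite_partitions: "finite (partitions N k i)"
  unfolding partitions_def
  by (rule finite_subset[of _ "{1..N} \<rightarrow>\<^sub>E Pow (block N k i)"]) (auto intro!: finite_PiE simp: finite_block)

text \<open>The support of \<open>pmf_of_set\<close> is known only for nonempty finite sets, so an
  equal partition has to be exhibited.\<close>

lemma partitions_nonempty:
  assumes "i \<ge> 1"
  shows "partitions N k i \<noteq> {}"
proof -
  obtain R where R: "\<forall>j\<in>{1..N}. card (R j) = k" "disjoint_family_on R {1..N}" "(\<Union>j\<in>{1..N}. R j) = block N k i"
    using equipartition_exists[OF finite_block card_block[OF assms], of N k] by (elim exE conjE)
  have "\<forall>j\<in>{1..N}. R j \<in> Pow (block N k i)" unfolding R(3)[symmetric] by blast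
  moreover have "disjoint_family_on (restrict R {1..N}) {1..N}"
    using R(2) by (simp add: disjoint_family_on_def)
  ultimately have "restrict R {1..N} \<in> partitions N k i"
    unfolding partitions_def using R(1,3) by (simp add: restrict_PiE_iff)
  thus ?thesis by blast
qed

section \<open>The run with the hash functions drawn last\<close>

definition distribution :: "nat \<Rightarrow> nat \<Rightarrow> nat set \<Rightarrow> (nat \<Rightarrow> nat \<Rightarrow> nat set) pmf" where
  "distribution N k C = Pi_pmf ({1..N} - C) undefined (\<lambda>i. pmf_of_set (partitions N k i))"

definition outcome ::
  "nat \<Rightarrow> nat \<Rightarrow> nat set \<Rightarrow> 'r coalition \<Rightarrow> (nat \<Rightarrow> nat \<Rightarrow> nat set) \<Rightarrow> 'r \<Rightarrow> (nat \<Rightarrow> hash) \<Rightarrow>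
     shares \<times> signed_doc \<times> signed_doc" where
  "outcome N k C A P \<rho> f =
     (let v = view_of N k C f P;
          m = (request A \<rho> v, \<lambda>r\<in>{1..N\<^sup>2 * k}. f r (request A \<rho> v))
      in (\<lambda>j i. if j \<in> C then deal A \<rho> v j i else share_of f (P j i), m, forge A \<rho> v m))"

text \<open>Functions, partitions and coins are independent, so the order of drawing is free. With
  the functions last, they are the only randomness left once partitions and coins are fixed.\<close>

lemma run_eq:
  "run N k F C A = do {
     P \<leftarrow> distribution N k C;
     \<rho> \<leftarrow> coins A;
     map_pmf (outcome N k C A P \<rho>) (Pi_pmf {1..N\<^sup>2 * k} undefined (\<lambda>_. pmf_of_set F))
   }"
proof -
  have "run N k F C A = do {
     f \<leftarrow> Pi_pmf {1..N\<^sup>2 * k} undefined (\<lambda>_. pmf_of_set F);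
     P \<leftarrow> distribution N k C;
     \<rho> \<leftarrow> coins A;
     return_pmf (outcome N k C A P \<rho> f)
   }"
    by (simp add: run_def distribution_def outcome_def Let_def)
  also have "\<dots> = do {
     P \<leftarrow> distribution N k C;
     f \<leftarrow> Pi_pmf {1..N\<^sup>2 * k} undefined (\<lambda>_. pmf_of_set F);
     \<rho> \<leftarrow> coins A;
     return_pmf (outcome N k C A P \<rho> f)
   }"
    by (rule bind_commute_pmf)
  also have "\<dots> = do {
     P \<leftarrow> distribution N k C;
     \<rho> \<leftarrow> coins A;
     f \<leftarrow> Pi_pmf {1..N\<^sup>2 * k} undefined (\<lambda>_. pmf_of_set F);
     return_pmf (outcome N k C A P \<rho> f)
   }"
    by (intro bind_pmf_cong refl bind_commute_pmf)
  finally show ?thesis by (simp add: map_pmf_def)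
qed

lemma set_distribution:
  assumes "P \<in> set_pmf (distribution N k C)" "j \<in> {1..N} - C"
  shows "P j \<in> partitions N k j"
proof -
  have "P \<in> PiE_dflt ({1..N} - C) undefined (\<lambda>i. set_pmf (pmf_of_set (partitions N k i)))"
    using assms(1) by (simp add: distribution_def set_Pi_pmf o_def)
  hence "P j \<in> set_pmf (pmf_of_set (partitions N k j))"
    using assms(2) unfolding PiE_dflt_def by blast
  thus ?thesis using finite_partitions partitions_nonempty[of j N k] assms(2) by simp
qed

text \<open>Fewer than \<open>\<sigma> * k\<close> mismatches leave strictly more than
  \<open>k * (1 - \<sigma>)\<close> matches; this strictness is the origin of the \<open>+ 1\<close>
  after the floor. As \<open>\<sigma> < 1\<close>, the floor is nonnegative and \<open>nat\<close>
  loses nothing.\<close>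

lemma test_threshold:
  assumes "finite S" "card S = k" "0 < \<sigma>" "\<sigma> < 1"
  shows "real (card {r \<in> S. \<not> Q r}) < \<sigma> * real k \<longleftrightarrow> nat \<lfloor>real k * (1 - \<sigma>)\<rfloor> + 1 \<le> card {r \<in> S. Q r}"
proof -
  have "card ({r \<in> S. \<not> Q r} \<union> {r \<in> S. Q r}) = card {r \<in> S. \<not> Q r} + card {r \<in> S. Q r}"
    using \<open>finite S\<close> by (intro card_Un_disjoint) auto
  moreover have "{r \<in> S. \<not> Q r} \<union> {r \<in> S. Q r} = S" by auto
  ultimately have "real k = real (card {r \<in> S. \<not> Q r}) + real (card {r \<in> S. Q r})"
    using assms(2) by simp
  hence "real (card {r \<in> S. \<not> Q r}) < \<sigma> * real k \<longleftrightarrow> real k * (1 - \<sigma>) < of_int (int (card {r \<in> S. Q r}))"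
    by (simp add: algebra_simps)
  also have "\<dots> \<longleftrightarrow> \<lfloor>real k * (1 - \<sigma>)\<rfloor> < int (card {r \<in> S. Q r})"
    by (simp only: floor_less_iff)
  also have "0 \<le> \<lfloor>real k * (1 - \<sigma>)\<rfloor>" using assms by simp
  hence "\<lfloor>real k * (1 - \<sigma>)\<rfloor> < int (card {r \<in> S. Q r}) \<longleftrightarrow>
      nat \<lfloor>real k * (1 - \<sigma>)\<rfloor> + 1 \<le> card {r \<in> S. Q r}"
    by linarith
  finally show ?thesis .
qed

text \<open>The table has an entry for every ordered pair of honest receivers, kept shares included,
  and is \<open>False\<close> elsewhere to match the default of \<open>Pi_pmf\<close>. Arbitrary
  \<open>E\<close> and \<open>\<sigma>\<close> cover forgery at level 0 with \<open>s 0\<close> as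
  well as the vote at level -1 with \<open>s (-1)\<close>.\<close>

lemma test_table:
  fixes N k :: nat and A :: "'r coalition" and E :: "(nat \<times> nat \<Rightarrow> bool) \<Rightarrow> bool"
  assumes asu: "almost_strongly_universal2 (2 powi (1 - int b\<^sub>H)) (bitstrings b\<^sub>M) (bitstrings b\<^sub>H) F"
    and "b\<^sub>H \<ge> 1" and C: "C \<subseteq> {1..N}" and A: "forger b\<^sub>M A"
    and \<sigma>: "0 < \<sigma>" "\<sigma> < 1" and E: "mono E"
  defines "H \<equiv> {1..N} - C"
  defines "success \<equiv> measure_pmf.prob (run N k F C A)
     {(K, m, m'). E (\<lambda>(j, i). j \<in> H \<and> i \<in> H \<and> real (mismatches (K j i) m') < \<sigma> * real k)}"
  defines "ideal \<equiv> measure_pmf.prob (Pi_pmf (H \<times> H) False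
     (\<lambda>_. bernoulli_pmf (Xi (nat \<lfloor>real k * (1 - \<sigma>)\<rfloor> + 1) k (2 powi (1 - int b\<^sub>H))))) {T. E T}"
  shows "success \<le> ideal"
    and "optimal_guesses N k b\<^sub>H F C A \<Longrightarrow> success = ideal"
proof -
  define p :: real where "p = 2 powi (1 - int b\<^sub>H)"
  have p: "p \<in> {0..1}"
    using power_int_increasing[of "1 - int b\<^sub>H" 0 "2 :: real"] \<open>b\<^sub>H \<ge> 1\<close> by (simp add: p_def)
  define c where "c = nat \<lfloor>real k * (1 - \<sigma>)\<rfloor> + 1"
  define W where "W = {(K, m :: signed_doc, m').
     E (\<lambda>(j, i). j \<in> H \<and> i \<in> H \<and> real (mismatches (K j i) m') < \<sigma> * real k)}"
  define D where "D = {1..N\<^sup>2 * k}"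
  define Fs where "Fs S = Pi_pmf S undefined (\<lambda>_. pmf_of_set F)" for S :: "nat set"
  have asu': "almost_strongly_universal2 p (bitstrings b\<^sub>M) (bitstrings b\<^sub>H) F"
    using asu by (simp add: p_def)
  have main: "measure_pmf.prob (map_pmf (outcome N k C A P \<rho>) (Fs D)) W \<le> ideal \<and>
    (optimal_guesses N k b\<^sub>H F C A \<longrightarrow> measure_pmf.prob (map_pmf (outcome N k C A P \<rho>) (Fs D)) W = ideal)"
    if P: "P \<in> set_pmf (distribution N k C)" and \<rho>: "\<rho> \<in> set_pmf (coins A)" for P \<rho>
  proof -
    define R where "R = (\<lambda>(j, i). P j i)"
    \<comment> \<open>\<open>U\<close> collects the indices of functions that only honest receivers
      hold. The blocks of the coalition and the shares handed to it are disjoint from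
      \<open>U\<close>, so its view depends on \<open>V\<close> alone.\<close>
    define U where "U = (\<Union>ji\<in>H \<times> H. R ji)"
    define V where "V = D - U"
    have part: "card (P j i) = k" "P j i \<subseteq> block N k j" if "j \<in> H" "i \<in> {1..N}" for j i
      using set_distribution[OF P, of j] that by (auto simp: H_def partitions_def PiE_iff)
    have disj: "P j i \<inter> P j' i' = {}" if "j \<in> H" "j' \<in> H" "i \<in> {1..N}" "i' \<in> {1..N}" "(j, i) \<noteq> (j', i')" for j i j' i'
    proof (cases "j = j'")
      case True
      thus ?thesis using set_distribution[OF P, of j] that
        by (auto simp: H_def partitions_def disjoint_family_on_def)
    next
      case False
      thus ?thesis using part(2)[of j i] part(2)[of j' i'] disjoint_blocks[of j j' N k] that
        by (auto simp: H_def)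
    qed
    have fin: "finite (P j i)" if "j \<in> H" "i \<in> {1..N}" for j i
      using part(2)[OF that] finite_block by (rule finite_subset)
    have HN: "H \<subseteq> {1..N}" "finite H" by (auto simp: H_def)
    have HI: "j \<in> {1..N}" if "j \<in> H" for j using that HN by blast
    have PD: "P j i \<subseteq> D" if "j \<in> H" "i \<in> {1..N}" for j i
      using part(2)[OF that] block_subset[OF HI[OF that(1)], of k] unfolding D_def by (rule subset_trans)
    have PU: "P j i \<subseteq> U" if "j \<in> H" "i \<in> H" for j i
      using that unfolding U_def R_def by blast
    have UE: "\<exists>j\<in>H. \<exists>i\<in>H. r \<in> P j i" if "r \<in> U" for r
      using that unfolding U_def R_def by blast
    have R: "finite (R ji)" "card (R ji) = k" if "ji \<in> H \<times> H" for ji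
      using fin[of "fst ji" "snd ji"] part(1)[of "fst ji" "snd ji"] HI[of "snd ji"] that
      by (simp_all add: R_def case_prod_unfold mem_Times_iff)
    have disjR: "disjoint_family_on R (H \<times> H)"
    proof (unfold disjoint_family_on_def, intro ballI impI)
      fix x y assume "x \<in> H \<times> H" "y \<in> H \<times> H" "x \<noteq> y"
      thus "R x \<inter> R y = {}"
        using disj[of "fst x" "fst y" "snd x" "snd y"] HI
        by (simp add: R_def case_prod_unfold mem_Times_iff prod_eq_iff)
    qed
    have UD: "U \<subseteq> D"
      using UE PD HI by blast
    have "finite U"
      using UD by (rule finite_subset) (simp add: D_def)
    have blockV: "block N k c \<subseteq> V" if "c \<in> C" for c
    proof -
      have "block N k c \<inter> P j i = {}" if "j \<in> H" "i \<in> H" for j i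
      proof -
        have "c \<noteq> j" "c \<ge> 1" "j \<ge> 1" using that(1) \<open>c \<in> C\<close> C by (auto simp: H_def)
        from disjoint_blocks[OF this(2,3,1), of N k] show ?thesis
          using part(2)[OF that(1) HI[OF that(2)]] by blast
      qed
      moreover have "block N k c \<subseteq> D" unfolding D_def using that C by (intro block_subset) blast
      ultimately show ?thesis using UE unfolding V_def by blast
    qed
    have shareV: "P j c \<subseteq> V" if "j \<in> H" "c \<in> C" for j c
    proof -
      have "P j c \<inter> P j' i = {}" if "j' \<in> H" "i \<in> H" for j' i
      proof (rule disj)
        show "c \<in> {1..N}" "i \<in> {1..N}" "(j, c) \<noteq> (j', i)"
          using that \<open>c \<in> C\<close> C by (auto simp: H_def)
      qed fact+
      moreover have "P j c \<subseteq> D" using that C by (intro PD) blast+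
      ultimately show ?thesis using UE unfolding V_def by blast
    qed
    have view: "view_of N k C f P = view_of N k C f' P" if "\<And>r. r \<in> V \<Longrightarrow> f r = f' r" for f f'
    proof -
      have "restrict f (\<Union>c\<in>C. block N k c) = restrict f' (\<Union>c\<in>C. block N k c)"
        using that blockV by (intro restrict_ext) blast
      moreover have "share_of f (P j c) = share_of f' (P j c)" if "j \<in> {1..N} - C" "c \<in> C" for j c
        unfolding share_of_def using \<open>\<And>r. r \<in> V \<Longrightarrow> f r = f' r\<close> shareV[of j c] that
        by (intro arg_cong[where f = "Pair _"] restrict_ext) (auto simp: H_def)
      ultimately show ?thesis
        unfolding view_of_def prod.inject
        by (intro conjI restrict_ext[of "{1..N} - C"] restrict_ext[of C]) blast+
    qed
    define merge where "merge a b = (\<lambda>r. if r \<in> V then a r else b r)" for a b :: "nat \<Rightarrow> hash"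
    have FsD: "Fs D = bind_pmf (Fs V) (\<lambda>a. map_pmf (merge a) (Fs U))"
    proof -
      have "V \<union> U = D" "V \<inter> U = {}" "finite V" using UD by (auto simp: V_def D_def)
      hence "Fs D = map_pmf (\<lambda>(a, b). merge a b) (pair_pmf (Fs V) (Fs U))"
        unfolding Fs_def merge_def
        using Pi_pmf_union[OF \<open>finite V\<close> \<open>finite U\<close>, of undefined "\<lambda>_. pmf_of_set F"] by simp
      thus ?thesis
        by (simp add: pair_pmf_def map_pmf_def bind_assoc_pmf bind_return_pmf)
    qed
    have inner: "measure_pmf.prob (map_pmf (outcome N k C A P \<rho>) (map_pmf (merge a) (Fs U))) W \<le> ideal \<and>
       (optimal_guesses N k b\<^sub>H F C A \<longrightarrow>
          measure_pmf.prob (map_pmf (outcome N k C A P \<rho>) (map_pmf (merge a) (Fs U))) W = ideal)"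
      if a: "a \<in> set_pmf (Fs V)" for a
    proof -
      define v where "v = view_of N k C a P"
      define x where "x = request A \<rho> v"
      \<comment> \<open>On \<open>V\<close> the tags come from the fixed \<open>a\<close>, so the
        signature is a function of the tags on \<open>U\<close>. Thus the forged pair
        \<open>m' (t b)\<close> sees \<open>b\<close> only through \<open>t b\<close>, which is the
        adaptivity that \<open>tag_guessing\<close> permits.\<close>
      define sig where "sig t = (\<lambda>r\<in>D. if r \<in> U then t r else a r x)" for t
      define m' where "m' t = forge A \<rho> v (x, sig t)" for t
      define t where "t b = (\<lambda>r\<in>U. b r x)" for b :: "nat \<Rightarrow> hash"
      have v: "view_of N k C (merge a b) P = v" for b
        unfolding v_def by (rule view) (simp add: merge_def)
      have sig: "(\<lambda>r\<in>D. merge a b r x) = sig (t b)" for b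
        by (auto simp: sig_def t_def merge_def V_def fun_eq_iff)
      have outc: "outcome N k C A P \<rho> (merge a b) =
          (\<lambda>j i. if j \<in> C then deal A \<rho> v j i else share_of (merge a b) (P j i), (x, sig (t b)), m' (t b))" for b
        unfolding outcome_def Let_def v x_def[symmetric] D_def[symmetric] sig m'_def ..
      have x: "x \<in> bitstrings b\<^sub>M" using A unfolding forger_def x_def by blast
      have "fst m = x \<Longrightarrow> fst (forge A \<rho> v m) \<in> bitstrings b\<^sub>M \<and> fst (forge A \<rho> v m) \<noteq> fst m" for m
        using A unfolding forger_def x_def by blast
      from this[of "(x, sig _)"]
      have x': "fst (m' \<tau>) \<in> bitstrings b\<^sub>M" "fst (m' \<tau>) \<noteq> x" for \<tau>
        unfolding m'_def fst_conv by blast+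
      define E' where "E' M = E (\<lambda>ji. ji \<in> H \<times> H \<and> c \<le> card {r \<in> R ji. M r})" for M
      have "mono E'"
      proof (rule monoI)
        fix M M' :: "nat \<Rightarrow> bool" assume "M \<le> M'"
        have "c \<le> card {r \<in> R ji. M' r}" if "ji \<in> H \<times> H" "c \<le> card {r \<in> R ji. M r}" for ji
        proof -
          from monoD[OF mono_card_ge[OF R(1)[OF that(1)], of c] \<open>M \<le> M'\<close>] that(2) show ?thesis by simp
        qed
        hence "(\<lambda>ji. ji \<in> H \<times> H \<and> c \<le> card {r \<in> R ji. M r}) \<le> (\<lambda>ji. ji \<in> H \<times> H \<and> c \<le> card {r \<in> R ji. M' r})"
          by (intro le_funI le_boolI) blast
        thus "E' M \<le> E' M'" unfolding E'_def by (rule monoD[OF E])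
      qed
      have event: "outcome N k C A P \<rho> (merge a b) \<in> W \<longleftrightarrow>
          E' (\<lambda>r. r \<in> U \<and> b r (fst (m' (t b))) = snd (m' (t b)) r)" for b
      proof -
        have "real (mismatches (share_of (merge a b) (P j i)) (m' (t b))) < \<sigma> * real k \<longleftrightarrow>
             c \<le> card {r \<in> R (j, i). r \<in> U \<and> b r (fst (m' (t b))) = snd (m' (t b)) r}"
          if "j \<in> H" "i \<in> H" for j i
        proof -
          have "{r \<in> P j i. snd (m' (t b)) r \<noteq> restrict (merge a b) (P j i) r (fst (m' (t b)))}
              = {r \<in> P j i. \<not> (r \<in> U \<and> b r (fst (m' (t b))) = snd (m' (t b)) r)}"
            using PU[OF that] by (auto simp: merge_def V_def)
          moreover have "finite (P j i)" "card (P j i) = k"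
            using that(1) HI[OF that(2)] by (rule fin part(1))+
          ultimately show ?thesis
            unfolding mismatches_def share_of_def fst_conv snd_conv c_def R_def prod.case
            by (simp only: test_threshold[OF _ _ \<sigma>])
        qed
        hence "(\<lambda>(j, i). j \<in> H \<and> i \<in> H \<and>
             real (mismatches (if j \<in> C then deal A \<rho> v j i else share_of (merge a b) (P j i)) (m' (t b))) < \<sigma> * real k)
          = (\<lambda>ji. ji \<in> H \<times> H \<and> c \<le> card {r \<in> R ji. r \<in> U \<and> b r (fst (m' (t b))) = snd (m' (t b)) r})"
          by (auto simp: fun_eq_iff H_def)
        thus ?thesis by (simp add: outc W_def E'_def)
      qed
      have "measure_pmf.prob (Pi_pmf U False (\<lambda>_. bernoulli_pmf p)) {M. E' M}
          = measure_pmf.prob (map_pmf (\<lambda>M ji. ji \<in> H \<times> H \<and> c \<le> card {r \<in> R ji. M r}) (Pi_pmf U False (\<lambda>_. bernoulli_pmf p))) {T. E T}"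
        by (simp add: E'_def vimage_def)
      also have "\<dots> = ideal"
      proof -
        have "map_pmf (\<lambda>M ji. ji \<in> H \<times> H \<and> c \<le> card {r \<in> R ji. M r}) (Pi_pmf U False (\<lambda>_. bernoulli_pmf p))
           = Pi_pmf (H \<times> H) False (\<lambda>_. bernoulli_pmf (Xi c k p))"
          unfolding U_def
          using HN R disjR p by (intro Pi_bernoulli_block_count finite_cartesian_product) simp_all
        thus ?thesis by (simp add: ideal_def c_def p_def)
      qed
      finally have id: "measure_pmf.prob (Pi_pmf U False (\<lambda>_. bernoulli_pmf p)) {M. E' M} = ideal" .
      have pr: "measure_pmf.prob (map_pmf (outcome N k C A P \<rho>) (map_pmf (merge a) (Fs U))) W
         = measure_pmf.prob (Fs U) {b. E' (\<lambda>r. r \<in> U \<and> b r (fst (m' (t b))) = snd (m' (t b)) r)}"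
        by (simp add: vimage_def event)
      note guess = tag_guessing[where x' = "\<lambda>\<tau>. fst (m' \<tau>)" and g = "\<lambda>\<tau>. snd (m' \<tau>)" and d = undefined,
          OF asu' finite_bitstrings p \<open>finite U\<close> x x' \<open>mono E'\<close>, folded t_def Fs_def, unfolded id]
      have "measure_pmf.prob (Fs U) {b. E' (\<lambda>r. r \<in> U \<and> b r (fst (m' (t b))) = snd (m' (t b)) r)} = ideal"
        if opt: "optimal_guesses N k b\<^sub>H F C A"
      proof (rule guess(2))
        fix b r assume b: "b \<in> set_pmf (Fs U)" and "r \<in> U"
        then obtain j i where ji: "j \<in> H" "i \<in> H" "r \<in> P j i" using UE by blast
        \<comment> \<open>\<open>optimal_guesses\<close> speaks only about outcomes in the support
          of the run, so the fixed pieces are reassembled into one such outcome.\<close>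
        have "outcome N k C A P \<rho> (merge a b) \<in> set_pmf (map_pmf (outcome N k C A P \<rho>) (Fs D))"
          unfolding FsD set_map_pmf set_bind_pmf using a b by blast
        hence "outcome N k C A P \<rho> (merge a b) \<in> set_pmf (run N k F C A)"
          unfolding run_eq set_bind_pmf D_def Fs_def by (intro UN_I[OF P] UN_I[OF \<rho>])
        note bspec[OF opt[unfolded optimal_guesses_def] this, unfolded outc prod.case, rule_format, of i j r]
        with ji have "measure_pmf.prob (pmf_of_set F) {h. h x = sig (t b) r \<and> h (fst (m' (t b))) = snd (m' (t b)) r}
            = 2 powi (1 - int b\<^sub>H) / 2 ^ b\<^sub>H"
          by (simp add: H_def share_of_def)
        moreover have "sig (t b) r = b r x" using \<open>r \<in> U\<close> UD by (auto simp: sig_def t_def)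
        ultimately show "measure_pmf.prob (pmf_of_set F) {h. h x = b r x \<and> h (fst (m' (t b))) = snd (m' (t b)) r}
            = p / real (card (bitstrings b\<^sub>H))"
          by (simp add: p_def card_bitstrings)
      qed
      thus ?thesis unfolding pr using guess(1) by blast
    qed
    have bind: "map_pmf (outcome N k C A P \<rho>) (Fs D)
       = bind_pmf (Fs V) (\<lambda>a. map_pmf (outcome N k C A P \<rho>) (map_pmf (merge a) (Fs U)))"
      unfolding FsD map_bind_pmf ..
    show ?thesis
    proof (intro conjI impI)
      show "measure_pmf.prob (map_pmf (outcome N k C A P \<rho>) (Fs D)) W \<le> ideal"
        unfolding bind ideal_def
        by (rule prob_bind_pmf_le) (rule conjunct1[OF inner[unfolded ideal_def]])
      assume opt: "optimal_guesses N k b\<^sub>H F C A"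
      show "measure_pmf.prob (map_pmf (outcome N k C A P \<rho>) (Fs D)) W = ideal"
        unfolding bind ideal_def
        by (rule prob_bind_pmf_eq) (rule mp[OF conjunct2[OF inner[unfolded ideal_def]] opt])
    qed
  qed
  have success: "success = measure_pmf.prob (distribution N k C \<bind> (\<lambda>P. coins A \<bind> (\<lambda>\<rho>.
      map_pmf (outcome N k C A P \<rho>) (Fs D)))) W"
    unfolding success_def run_eq W_def Fs_def D_def ..
  show "success \<le> ideal"
    unfolding success ideal_def
    by (rule prob_bind_pmf_le, rule prob_bind_pmf_le) (rule conjunct1[OF main[unfolded ideal_def]])
  assume opt: "optimal_guesses N k b\<^sub>H F C A"
  show "success = ideal"
    unfolding success ideal_def
    by (rule prob_bind_pmf_eq, rule prob_bind_pmf_eq) (rule mp[OF conjunct2[OF main[unfolded ideal_def]] opt])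
qed

section \<open>Forgery and majority vote\<close>

text \<open>The tests made by different receivers \<open>i\<close> occupy disjoint columns
  \<open>H \<times> {i}\<close>; this is the second use of the block lemma.\<close>

lemma column_counts:
  assumes "finite H" "q \<in> {0..1}"
  shows "map_pmf (\<lambda>T i. i \<in> H \<and> card {j \<in> H. T (j, i)} \<ge> a) (Pi_pmf (H \<times> H) False (\<lambda>_. bernoulli_pmf q))
           = Pi_pmf H False (\<lambda>_. bernoulli_pmf (Xi a (card H) q))"
proof -
  have card: "card {r \<in> H \<times> {i}. T r} = card {j \<in> H. T (j, i)}" for T i
  proof -
    have "{r \<in> H \<times> {i}. T r} = (\<lambda>j. (j, i)) ` {j \<in> H. T (j, i)}" by auto
    thus ?thesis by (simp add: card_image inj_on_def)
  qed
  have "(\<Union>i\<in>H. H \<times> {i}) = H \<times> H" by auto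
  moreover have "disjoint_family_on (\<lambda>i. H \<times> {i}) H" by (auto simp: disjoint_family_on_def)
  ultimately show ?thesis
    using Pi_bernoulli_block_count[of H "\<lambda>i. H \<times> {i}" "card H" q a] assms
    by (simp add: card card_cartesian_product)
qed

lemma sum_tests:
  assumes "C \<subseteq> {1..N}"
  shows "(\<Sum>j=1..N. test k s K i j l m)
           = card {j \<in> {1..N} - C. real (mismatches (K j i) m) < s l * real k} + (\<Sum>j\<in>C. test k s K i j l m)"
proof -
  have "(\<Sum>j=1..N. test k s K i j l m) = (\<Sum>j\<in>{1..N} - C. test k s K i j l m) + (\<Sum>j\<in>C. test k s K i j l m)"
    using assms by (intro sum.subset_diff) auto
  also have "(\<Sum>j\<in>{1..N} - C. test k s K i j l m) = (\<Sum>j\<in>{j \<in> {1..N} - C. real (mismatches (K j i) m) < s l * real k}. 1)"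
    unfolding test_def by (intro sum.inter_filter[symmetric]) auto
  finally show ?thesis by simp
qed

lemma sum_tests_le: "finite C \<Longrightarrow> (\<Sum>j\<in>C. test k s K i j l m) \<le> card C"
  using sum_bounded_above[of C "\<lambda>j. test k s K i j l m" 1] by (auto simp: test_def)

text \<open>The threshold \<open>N * delta N \<omega> 0\<close> is
  \<open>N / 2 + \<omega> - 1\<close>, and the coalition contributes at most \<open>card C\<close>
  passed tests. So the honest count exceeds \<open>N / 2 - 1 + (\<omega> - card C)\<close>, and
  integrality raises this to the stated number for either parity of \<open>N\<close>.\<close>

lemma Ver_0_imp:
  assumes "C \<subseteq> {1..N}" "card C \<le> \<omega>" "N \<ge> 1" and V: "Ver N k \<omega> s K i 0 m"
  shows "N div 2 + (\<omega> - card C) \<le> card {j \<in> {1..N} - C. real (mismatches (K j i) m) < s 0 * real k}"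
    (is "_ \<le> ?c")
proof -
  define t where "t = (\<Sum>j=1..N. test k s K i j 0 m)"
  have "t \<le> ?c + card C"
    using sum_tests[OF assms(1), of k s K i 0 m] sum_tests_le[of C k s K i 0 m] finite_subset[OF assms(1)]
    by (simp add: t_def)
  hence "real t \<le> real ?c + real (card C)" by linarith
  moreover have "real N * delta N \<omega> 0 = real N / 2 + real \<omega> - 1"
    using \<open>N \<ge> 1\<close> by (simp add: delta_def d_R_def field_simps)
  moreover have "real t > real N * delta N \<omega> 0" using V unfolding Ver_def t_def .
  ultimately have "real N / 2 + real \<omega> - 1 < real ?c + real (card C)" by linarith
  hence "real (N + 2 * \<omega>) < real (2 * ?c + 2 * card C + 2)" by simp
  hence "N + 2 * \<omega> < 2 * ?c + 2 * card C + 2" by (simp only: of_nat_less_iff)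
  thus ?thesis using assms(2) by linarith
qed

text \<open>The factor \<open>l + 1\<close> vanishes at level -1, so the threshold is
  \<open>N / 2\<close>: a strict majority of the tests.\<close>

lemma Ver_minus1_iff:
  assumes "N \<ge> 1"
  shows "Ver N k \<omega> s K i (-1) m \<longleftrightarrow> N div 2 + 1 \<le> (\<Sum>j=1..N. test k s K i j (-1) m)"
    (is "_ \<longleftrightarrow> _ \<le> ?t")
proof -
  have "real N * delta N \<omega> (-1) = real N / 2" by (simp add: delta_def)
  hence "Ver N k \<omega> s K i (-1) m \<longleftrightarrow> real N < real (2 * ?t)" unfolding Ver_def by linarith
  also have "\<dots> \<longleftrightarrow> N < 2 * ?t" by (simp only: of_nat_less_iff)
  also have "\<dots> \<longleftrightarrow> N div 2 + 1 \<le> ?t" by linarith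
  finally show ?thesis .
qed

lemma MV_vote_iff:
  assumes "C \<subseteq> {1..N}" "card C = \<omega>"
  shows "MV N (vote N k \<omega> s C K m) \<longleftrightarrow>
           N div 2 + 1 - \<omega> \<le> card {i \<in> {1..N} - C. Ver N k \<omega> s K i (-1) m}"
proof -
  have "{i \<in> {1..N}. vote N k \<omega> s C K m i} = C \<union> {i \<in> {1..N} - C. Ver N k \<omega> s K i (-1) m}"
    using assms(1) by (auto simp: vote_def)
  moreover have "card (C \<union> {i \<in> {1..N} - C. Ver N k \<omega> s K i (-1) m})
      = \<omega> + card {i \<in> {1..N} - C. Ver N k \<omega> s K i (-1) m}"
    using finite_subset[OF assms(1)] assms(2) by (subst card_Un_disjoint) auto
  ultimately have "card {i \<in> {1..N}. vote N k \<omega> s C K m i} = \<omega> + card {i \<in> {1..N} - C. Ver N k \<omega> s K i (-1) m}"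
    by (simp only:)
  thus ?thesis unfolding MV_def by linarith
qed

text \<open>A union bound over the honest receivers, followed by a comparison of every coalition
  size with \<open>\<omega>\<close>.\<close>

lemma forgery_bound:
  fixes N k :: nat and s :: "int \<Rightarrow> real" and A :: "'r coalition"
  assumes asu: "almost_strongly_universal2 (2 powi (1 - int b\<^sub>H)) (bitstrings b\<^sub>M) (bitstrings b\<^sub>H) F"
    and "b\<^sub>H \<ge> 1" and C: "C \<subseteq> {1..N}" "card C \<le> \<omega>" and A: "forger b\<^sub>M A"
    and "N \<ge> 1" and "k \<ge> 1" and "2 * \<omega> \<le> N" and s: "0 < s 0" "s 0 < 1 / 2"
  defines "p_t \<equiv> Xi (nat \<lfloor>real k * (1 - s 0)\<rfloor> + 1) k (2 powi (1 - int b\<^sub>H))"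
  shows "measure_pmf.prob (run N k F C A) {(K, m, m'). \<exists>i\<in>{1..N} - C. Ver N k \<omega> s K i 0 m'}
           \<le> real (N - \<omega>) * Xi (N div 2) (N - \<omega>) p_t"
proof -
  define H where "H = {1..N} - C"
  define a where "a = N div 2 + (\<omega> - card C)"
  define tab where "tab K m' = (\<lambda>(j, i). j \<in> H \<and> i \<in> H \<and> real (mismatches (K j i) m') < s 0 * real k)"
    for K :: shares and m'
  define p :: real where "p = 2 powi (1 - int b\<^sub>H)"
  have "finite C" using C(1) by (rule finite_subset) simp
  have H: "finite H" "card H = N - card C"
    using C \<open>finite C\<close> by (auto simp: H_def card_Diff_subset)
  have p01: "p \<in> {0..1}"
    using power_int_increasing[of "1 - int b\<^sub>H" 0 "2 :: real"] \<open>b\<^sub>H \<ge> 1\<close> by (simp add: p_def)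
  have pt01: "p_t \<in> {0..1}" unfolding p_t_def using p01 by (intro Xi_in_unit) (simp add: p_def)
  have mono: "mono (\<lambda>T. \<exists>i\<in>H. a \<le> card {j \<in> H. T (j, i)})"
  proof (rule monoI, rule le_boolI, erule bexE)
    fix T T' :: "nat \<times> nat \<Rightarrow> bool" and i
    assume "T \<le> T'" "i \<in> H" and le: "a \<le> card {j \<in> H. T (j, i)}"
    have "card {j \<in> H. T (j, i)} \<le> card {j \<in> H. T' (j, i)}"
      using \<open>T \<le> T'\<close> H(1) by (intro card_mono) (auto simp: le_fun_def)
    thus "\<exists>i\<in>H. a \<le> card {j \<in> H. T' (j, i)}" using le \<open>i \<in> H\<close> by (intro bexI[of _ i]) auto
  qed
  have imp: "\<exists>i\<in>H. a \<le> card {j \<in> H. tab K m (j, i)}" if "\<exists>i\<in>H. Ver N k \<omega> s K i 0 m" for K m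
  proof -
    obtain i where i: "i \<in> H" "Ver N k \<omega> s K i 0 m" using \<open>\<exists>i\<in>H. _ i\<close> by (elim bexE)
    have "a \<le> card {j \<in> H. real (mismatches (K j i) m) < s 0 * real k}"
      unfolding H_def a_def by (rule Ver_0_imp[OF C \<open>N \<ge> 1\<close> i(2)])
    moreover have "{j \<in> H. real (mismatches (K j i) m) < s 0 * real k} = {j \<in> H. tab K m (j, i)}"
      using i(1) by (auto simp: tab_def)
    ultimately show ?thesis using i(1) by (intro bexI[of _ i]) simp_all
  qed
  have "measure_pmf.prob (run N k F C A) {(K, m, m'). \<exists>i\<in>H. Ver N k \<omega> s K i 0 m'}
     \<le> measure_pmf.prob (run N k F C A) {(K, m, m'). \<exists>i\<in>H. a \<le> card {j \<in> H. tab K m' (j, i)}}"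
    by (intro prob_pmf_mono) (use imp in \<open>simp only: mem_Collect_eq split_beta\<close>)
  also have "\<dots> \<le> measure_pmf.prob (Pi_pmf (H \<times> H) False (\<lambda>_. bernoulli_pmf p_t))
       {T. \<exists>i\<in>H. a \<le> card {j \<in> H. T (j, i)}}"
  proof -
    have "s 0 < 1" using s(2) by simp
    from test_table(1)[OF asu \<open>b\<^sub>H \<ge> 1\<close> C(1) A s(1) this mono, of k, folded H_def, folded tab_def p_t_def]
    show ?thesis .
  qed
  also have "\<dots> = measure_pmf.prob (Pi_pmf H False (\<lambda>_. bernoulli_pmf (Xi a (card H) p_t))) (\<Union>i\<in>H. {V. V i})"
    unfolding column_counts[OF H(1) pt01, symmetric] measure_map_pmf
    by (rule arg_cong[where f = "measure_pmf.prob _"]) auto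
  also have "\<dots> \<le> (\<Sum>i\<in>H. measure_pmf.prob (Pi_pmf H False (\<lambda>_. bernoulli_pmf (Xi a (card H) p_t))) {V. V i})"
    using H(1) by (intro measure_pmf.finite_measure_subadditive_finite) auto
  also have "\<dots> = (\<Sum>i\<in>H. Xi a (card H) p_t)"
  proof (rule sum.cong[OF refl])
    fix i assume "i \<in> H"
    have "measure_pmf.prob (Pi_pmf H False (\<lambda>_. bernoulli_pmf (Xi a (card H) p_t))) {V. V i}
        = measure_pmf.prob (map_pmf (\<lambda>V. V i) (Pi_pmf H False (\<lambda>_. bernoulli_pmf (Xi a (card H) p_t)))) {True}"
      by (simp add: vimage_def)
    also have "\<dots> = Xi a (card H) p_t"
      using \<open>i \<in> H\<close> Xi_in_unit[OF pt01, of a "card H"]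
      by (simp add: Pi_pmf_component[OF H(1)] measure_pmf_single)
    finally show "measure_pmf.prob (Pi_pmf H False (\<lambda>_. bernoulli_pmf (Xi a (card H) p_t))) {V. V i}
        = Xi a (card H) p_t" .
  qed
  finally have bound: "measure_pmf.prob (run N k F C A) {(K, m, m'). \<exists>i\<in>H. Ver N k \<omega> s K i 0 m'}
      \<le> real (N - card C) * Xi a (N - card C) p_t"
    using H by simp
  show ?thesis
  proof (cases "b\<^sub>H = 1")
    case True
    have "real k * (1 - s 0) < real k" using s \<open>k \<ge> 1\<close> by simp
    hence "\<lfloor>real k * (1 - s 0)\<rfloor> < int k" by (simp add: floor_less_iff)
    hence "nat \<lfloor>real k * (1 - s 0)\<rfloor> + 1 \<le> k" using \<open>k \<ge> 1\<close> by linarith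
    hence "p_t = 1" unfolding p_t_def using True by (simp add: Xi_1 del: Suc_eq_plus1 add_Suc_right)
    hence "real (N - \<omega>) * Xi (N div 2) (N - \<omega>) p_t = real (N - \<omega>)"
      using \<open>2 * \<omega> \<le> N\<close> by (simp add: Xi_1)
    moreover have "1 \<le> N - \<omega>" using \<open>N \<ge> 1\<close> \<open>2 * \<omega> \<le> N\<close> by linarith
    ultimately have "1 \<le> real (N - \<omega>) * Xi (N div 2) (N - \<omega>) p_t" by (simp only: one_of_nat_le_iff)
    thus ?thesis by (rule order_trans[OF measure_pmf.prob_le_1])
  next
    case False
    have "p \<le> 2 powi (- 1)"
      unfolding p_def using False \<open>b\<^sub>H \<ge> 1\<close> by (intro power_int_increasing) auto
    hence p: "0 \<le> p" "p \<le> 1 / 2" using p01 by (simp_all add: power_int_minus)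
    \<comment> \<open>As \<open>s 0 < 1 / 2\<close>, a test needs more than \<open>k / 2\<close>
      matches, which is the hypothesis of \<open>Xi_le_half\<close>.\<close>
    have "k < 2 * (nat \<lfloor>x\<rfloor> + 1)" if "real k \<le> 2 * x" for x
      using that by (simp, linarith)
    moreover have "real k * 1 \<le> real k * (2 * (1 - s 0))" using s by (intro mult_left_mono) auto
    hence "real k \<le> 2 * (real k * (1 - s 0))" by (simp only: mult_1_right mult.left_commute)
    ultimately have "k < 2 * (nat \<lfloor>real k * (1 - s 0)\<rfloor> + 1)" by blast
    hence pt: "0 \<le> p_t" "p_t \<le> 1 / 2"
      using pt01 Xi_le_half[OF p] by (simp_all add: p_t_def p_def)
    \<comment> \<open>The side condition amounts to
      \<open>N - card C \<le> 2 * (N div 2) + 1\<close>.\<close>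
    have "real (N - \<omega> + (\<omega> - card C)) * Xi (N div 2 + (\<omega> - card C)) (N - \<omega> + (\<omega> - card C)) p_t
        \<le> real (N - \<omega>) * Xi (N div 2) (N - \<omega>) p_t"
      using \<open>2 * \<omega> \<le> N\<close> \<open>N \<ge> 1\<close> by (intro mult_Xi_add_le pt) linarith+
    moreover have "N - \<omega> + (\<omega> - card C) = N - card C" using C(2) \<open>2 * \<omega> \<le> N\<close> by linarith
    ultimately show ?thesis using bound by (simp add: a_def H_def)
  qed
qed

text \<open>A valid vote forces a nested threshold event on the table of honest tests, whatever
  shares the coalition sent. If the tests of its own shares all pass, both events coincide, and
  optimal guesses give the table event its ideal probability.\<close>

lemma majority_vote_attack:
  fixes N k :: nat and s :: "int \<Rightarrow> real" and A :: "'r coalition"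
  assumes asu: "almost_strongly_universal2 (2 powi (1 - int b\<^sub>H)) (bitstrings b\<^sub>M) (bitstrings b\<^sub>H) F"
    and "b\<^sub>H \<ge> 1" and C: "C \<subseteq> {1..N}" "card C = \<omega>" and A: "forger b\<^sub>M A"
    and "N \<ge> 1" and s: "0 < s (-1)" "s (-1) < 1"
  defines "q_t \<equiv> Xi (nat \<lfloor>real k * (1 - s (-1))\<rfloor> + 1) k (2 powi (1 - int b\<^sub>H))"
    and "a \<equiv> N div 2 + 1 - \<omega>"
  defines "success \<equiv> measure_pmf.prob (run N k F C A) {(K, m, m'). MV N (vote N k \<omega> s C K m')}"
  shows "success \<le> Xi a (N - \<omega>) (Xi a (N - \<omega>) q_t)"
    and "own_tests_pass N k s F C A \<Longrightarrow> optimal_guesses N k b\<^sub>H F C A \<Longrightarrow>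
           success = Xi a (N - \<omega>) (Xi a (N - \<omega>) q_t)"
proof -
  define H where "H = {1..N} - C"
  define tab where "tab K m' = (\<lambda>(j, i). j \<in> H \<and> i \<in> H \<and> real (mismatches (K j i) m') < s (-1) * real k)"
    for K :: shares and m'
  \<comment> \<open>The same \<open>a\<close> occurs twice because the coalition supplies up to
    \<open>\<omega>\<close> of the \<open>N div 2 + 1\<close> tests needed by a receiver and
    \<open>\<omega>\<close> of the \<open>N div 2 + 1\<close> votes.\<close>
  define E where "E T \<longleftrightarrow> a \<le> card {i \<in> H. a \<le> card {j \<in> H. T (j, i)}}" for T :: "nat \<times> nat \<Rightarrow> bool"
  have "finite C" using C(1) by (rule finite_subset) simp
  have H: "finite H" "card H = N - \<omega>"
    using C \<open>finite C\<close> by (auto simp: H_def card_Diff_subset)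
  have q01: "q_t \<in> {0..1}"
    unfolding q_t_def using power_int_increasing[of "1 - int b\<^sub>H" 0 "2 :: real"] \<open>b\<^sub>H \<ge> 1\<close>
    by (intro Xi_in_unit) simp
  have mono: "mono E"
  proof (rule monoI)
    fix T T' :: "nat \<times> nat \<Rightarrow> bool" assume "T \<le> T'"
    have "card {j \<in> H. T (j, i)} \<le> card {j \<in> H. T' (j, i)}" for i
      using \<open>T \<le> T'\<close> H(1) by (intro card_mono) (auto simp: le_fun_def)
    hence "card {i \<in> H. a \<le> card {j \<in> H. T (j, i)}} \<le> card {i \<in> H. a \<le> card {j \<in> H. T' (j, i)}}"
      using H(1) by (intro card_mono) (auto intro: order_trans)
    thus "E T \<le> E T'" unfolding E_def by (intro le_boolI) linarith
  qed
  have ideal: "measure_pmf.prob (Pi_pmf (H \<times> H) False (\<lambda>_. bernoulli_pmf q_t)) {T. E T}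
      = Xi a (N - \<omega>) (Xi a (N - \<omega>) q_t)"
  proof -
    have "measure_pmf.prob (Pi_pmf (H \<times> H) False (\<lambda>_. bernoulli_pmf q_t)) {T. E T}
        = measure_pmf.prob (Pi_pmf H False (\<lambda>_. bernoulli_pmf (Xi a (card H) q_t))) {V. a \<le> card {i \<in> H. V i}}"
      unfolding column_counts[OF H(1) q01, symmetric] measure_map_pmf
      by (rule arg_cong[where f = "measure_pmf.prob _"]) (auto simp: E_def cong: conj_cong)
    thus ?thesis using prob_Pi_bernoulli_count[OF H(1) Xi_in_unit[OF q01]] H(2) by simp
  qed
  have tests: "(\<Sum>j=1..N. test k s K i j (-1) m) = card {j \<in> H. tab K m (j, i)} + (\<Sum>j\<in>C. test k s K i j (-1) m)"
    if "i \<in> H" for K i m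
  proof -
    have "{j \<in> H. tab K m (j, i)} = {j \<in> {1..N} - C. real (mismatches (K j i) m) < s (-1) * real k}"
      using that by (auto simp: tab_def H_def)
    thus ?thesis using sum_tests[OF C(1), of k s K i "-1" m] by simp
  qed
  have imp: "E (tab K m)" if "MV N (vote N k \<omega> s C K m)" for K m
  proof -
    have "a \<le> card {j \<in> H. tab K m (j, i)}" if "i \<in> H" "Ver N k \<omega> s K i (-1) m" for i
      using that(2) tests[OF that(1), of K m] sum_tests_le[OF \<open>finite C\<close>, of k s K i "-1" m] C(2)
      unfolding Ver_minus1_iff[OF \<open>N \<ge> 1\<close>] a_def by linarith
    hence "card {i \<in> H. Ver N k \<omega> s K i (-1) m} \<le> card {i \<in> H. a \<le> card {j \<in> H. tab K m (j, i)}}"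
      using H(1) by (intro card_mono) auto
    thus ?thesis using that unfolding MV_vote_iff[OF C] E_def H_def[symmetric] a_def by linarith
  qed
  have iff: "MV N (vote N k \<omega> s C K m) \<longleftrightarrow> E (tab K m)"
    if pass: "\<forall>i\<in>H. \<forall>j\<in>C. test k s K i j (-1) m = 1" for K m
  proof -
    have "Ver N k \<omega> s K i (-1) m \<longleftrightarrow> a \<le> card {j \<in> H. tab K m (j, i)}" if "i \<in> H" for i
    proof -
      have "(\<Sum>j\<in>C. test k s K i j (-1) m) = \<omega>" using pass that C(2) by simp
      thus ?thesis using tests[OF that, of K m] unfolding Ver_minus1_iff[OF \<open>N \<ge> 1\<close>] a_def by linarith
    qed
    hence "{i \<in> H. Ver N k \<omega> s K i (-1) m} = {i \<in> H. a \<le> card {j \<in> H. tab K m (j, i)}}" by blast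
    thus ?thesis unfolding MV_vote_iff[OF C] E_def H_def[symmetric] a_def by simp
  qed
  note table = test_table[OF asu \<open>b\<^sub>H \<ge> 1\<close> C(1) A s mono, of k,
      folded H_def, folded tab_def q_t_def, unfolded ideal]
  have "success \<le> measure_pmf.prob (run N k F C A) {(K, m, m'). E (tab K m')}"
    unfolding success_def by (intro prob_pmf_mono) (use imp in \<open>simp only: mem_Collect_eq split_beta\<close>)
  also note table(1)
  finally show "success \<le> Xi a (N - \<omega>) (Xi a (N - \<omega>) q_t)" .
  assume "own_tests_pass N k s F C A" and opt: "optimal_guesses N k b\<^sub>H F C A"
  hence pass: "\<forall>i\<in>H. \<forall>j\<in>C. test k s (fst x) i j (-1) (snd (snd x)) = 1" if "x \<in> set_pmf (run N k F C A)" for x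
    using that unfolding own_tests_pass_def H_def split_beta by blast
  have "success = measure_pmf.prob (run N k F C A) {(K, m, m'). E (tab K m')}"
    unfolding success_def
    by (rule prob_pmf_cong, unfold mem_Collect_eq split_beta) (rule iff[OF pass])
  also note table(2)[OF opt]
  finally show "success = Xi a (N - \<omega>) (Xi a (N - \<omega>) q_t)" .
qed

text \<open>Makes the equality clause for the attack nonvacuous: a deterministic coalition answers
  each observed tag by a best guess for the other document.\<close>

lemma optimal_coalition_exists:
  fixes N k :: nat and s :: "int \<Rightarrow> real"
  assumes asu: "almost_strongly_universal2 \<epsilon> (bitstrings b\<^sub>M) (bitstrings b\<^sub>H) F"
    and C: "C \<subseteq> {1..N}" and "k \<ge> 1" and "s (-1) > 0"
    and d: "d \<in> bitstrings b\<^sub>M" "d' \<in> bitstrings b\<^sub>M" "d \<noteq> d'" and att: "bound_attained b\<^sub>H F d d'"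
  shows "\<exists>A :: 'r coalition. forger b\<^sub>M A \<and> own_tests_pass N k s F C A \<and> optimal_guesses N k b\<^sub>H F C A"
proof -
  define best where "best t = (SOME t'. t' \<in> bitstrings b\<^sub>H \<and>
     measure_pmf.prob (pmf_of_set F) {h. h d = t \<and> h d' = t'} = 2 powi (1 - int b\<^sub>H) / 2 ^ b\<^sub>H)" for t
  have best: "measure_pmf.prob (pmf_of_set F) {h. h d = t \<and> h d' = best t} = 2 powi (1 - int b\<^sub>H) / 2 ^ b\<^sub>H"
    if "t \<in> bitstrings b\<^sub>H" for t
  proof -
    from att that have "\<exists>t'\<in>bitstrings b\<^sub>H.
        measure_pmf.prob (pmf_of_set F) {h. h d = t \<and> h d' = t'} = 2 powi (1 - int b\<^sub>H) / 2 ^ b\<^sub>H"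
      unfolding bound_attained_def by (rule bspec)
    from someI_ex[OF this[unfolded Bex_def]] show ?thesis
      unfolding best_def by (rule conjunct2)
  qed
  \<comment> \<open>Empty shares have no mismatches, so their tests pass because
    \<open>s (-1) * k > 0\<close>.\<close>
  define A :: "'r coalition" where
    "A = \<lparr>coins = return_pmf undefined, deal = \<lambda>_ _ _ _. ({}, undefined), request = \<lambda>_ _. d,
          forge = \<lambda>_ _ m. (d', \<lambda>r. best (snd m r))\<rparr>"
  have F: "finite F" "F \<noteq> {}" "F \<subseteq> bitstrings b\<^sub>M \<rightarrow>\<^sub>E bitstrings b\<^sub>H"
    using asu by (auto simp: almost_strongly_universal2_def)
  have run: "\<exists>P\<in>set_pmf (distribution N k C). \<exists>\<rho>. \<exists>f\<in>PiE_dflt {1..N\<^sup>2 * k} undefined (\<lambda>_. F). x = outcome N k C A P \<rho> f"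
    if "x \<in> set_pmf (run N k F C A)" for x
  proof -
    have "set_pmf (Pi_pmf {1..N\<^sup>2 * k} undefined (\<lambda>_. pmf_of_set F)) = PiE_dflt {1..N\<^sup>2 * k} undefined (\<lambda>_. F)"
      using F by (simp add: set_Pi_pmf o_def)
    moreover obtain P \<rho> f where "P \<in> set_pmf (distribution N k C)" "x = outcome N k C A P \<rho> f"
      "f \<in> set_pmf (Pi_pmf {1..N\<^sup>2 * k} undefined (\<lambda>_. pmf_of_set F))"
      using \<open>x \<in> set_pmf _\<close> unfolding run_eq set_bind_pmf set_map_pmf by (elim UN_E imageE)
    ultimately show ?thesis by blast
  qed
  have "forger b\<^sub>M A" using d by (auto simp: forger_def A_def)
  moreover have "own_tests_pass N k s F C A"
    unfolding own_tests_pass_def split_beta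
  proof (intro ballI)
    fix x i j assume "x \<in> set_pmf (run N k F C A)" "j \<in> C"
    then obtain P \<rho> f where "x = outcome N k C A P \<rho> f" using run by blast
    hence "fst x j i = ({}, undefined)" using \<open>j \<in> C\<close> by (simp add: outcome_def Let_def A_def)
    thus "test k s (fst x) i j (-1) (snd (snd x)) = 1"
      using assms(3,4) by (simp add: test_def mismatches_def)
  qed
  moreover have "optimal_guesses N k b\<^sub>H F C A"
    unfolding optimal_guesses_def split_beta
  proof (intro ballI)
    fix x i j r assume x: "x \<in> set_pmf (run N k F C A)" and ij: "i \<in> {1..N} - C" "j \<in> {1..N} - C"
      and r: "r \<in> fst (fst x j i)"
    from run[OF x] obtain P \<rho> f where P: "P \<in> set_pmf (distribution N k C)"
      and f: "f \<in> PiE_dflt {1..N\<^sup>2 * k} undefined (\<lambda>_. F)" and xo: "x = outcome N k C A P \<rho> f" by blast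
    have "r \<in> P j i" using r ij by (simp add: xo outcome_def Let_def share_of_def)
    moreover have "P j i \<subseteq> block N k j"
      using set_distribution[OF P ij(2)] ij by (simp add: partitions_def PiE_iff)
    \<comment> \<open>The signature is \<open>undefined\<close> outside the index range; inside it,
      its entry at \<open>r\<close> is \<open>f r d\<close>.\<close>
    ultimately have rD: "r \<in> {1..N\<^sup>2 * k}" using block_subset[of j N k] ij by blast
    hence "f r \<in> F" using f unfolding PiE_dflt_def by blast
    hence "f r d \<in> bitstrings b\<^sub>H" using F(3) d(1) by (auto simp: PiE_iff)
    moreover have "fst (fst (snd x)) = d" "snd (fst (snd x)) r = f r d"
        "fst (snd (snd x)) = d'" "snd (snd (snd x)) r = best (f r d)"
      using rD by (simp_all add: xo outcome_def Let_def A_def)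
    ultimately show "measure_pmf.prob (pmf_of_set F) {h. h (fst (fst (snd x))) = snd (fst (snd x)) r \<and>
        h (fst (snd (snd x))) = snd (snd (snd x)) r} = 2 powi (1 - int b\<^sub>H) / 2 ^ b\<^sub>H"
      by (simp only: best)
  qed
  ultimately show ?thesis by blast
qed

text \<open>The vote compares with \<open>s (-1)\<close>, whereas \<open>p_t\<close> is formed with
  \<open>s 0\<close>; the numbers \<open>q_t\<close>, \<open>q_m1\<close>, \<open>q_attack\<close>
  are the counterparts at \<open>s (-1)\<close>. Since \<open>s 0 < s (-1)\<close>, the vote is the
  laxer check, so \<open>p_attack\<close> is a lower bound for the optimal attack, and the two agree
  when both thresholds round to the same number of matches.\<close>

theorem mainTheorem8:
  fixes N k \<omega> l_max b\<^sub>M b\<^sub>H :: nat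
    and s :: "int \<Rightarrow> real" and \<Delta>s :: real
    and F :: "hash set"
    and \<epsilon>_for p_t p_m1 p_attack q_t q_m1 q_attack :: real
  assumes "N \<ge> 1" and "k \<ge> 1" and "b\<^sub>H \<ge> 1"
    and "real \<omega> < (real N + 1) / 2"
    and "(real l_max + 1) * d_R N \<omega> < 1 / 2"
    and "s (-1) < 1 / 2" and "s (int l_max) > 0"
    and "\<Delta>s > 0" and "\<forall>l\<in>{0..int l_max}. s (l - 1) - s l = \<Delta>s"
    and "almost_strongly_universal2 (2 powi (1 - int b\<^sub>H)) (bitstrings b\<^sub>M) (bitstrings b\<^sub>H) F"
    and p_t_def: "p_t = Xi (nat \<lfloor>real k * (1 - s 0)\<rfloor> + 1) k (2 powi (1 - int b\<^sub>H))"
    and \<epsilon>_for_def: "\<epsilon>_for = real (N - \<omega>) * Xi (N div 2) (N - \<omega>) p_t"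
    and p_m1_def: "p_m1 = Xi (N div 2 + 1 - \<omega>) (N - \<omega>) p_t"
    and p_attack_def: "p_attack = Xi (N div 2 + 1 - \<omega>) (N - \<omega>) p_m1"
    and q_t_def: "q_t = Xi (nat \<lfloor>real k * (1 - s (-1))\<rfloor> + 1) k (2 powi (1 - int b\<^sub>H))"
    and q_m1_def: "q_m1 = Xi (N div 2 + 1 - \<omega>) (N - \<omega>) q_t"
    and q_attack_def: "q_attack = Xi (N div 2 + 1 - \<omega>) (N - \<omega>) q_m1"
  shows
    "(\<forall>C (A :: 'r coalition). C \<subseteq> {1..N} \<and> card C \<le> \<omega> \<and> forger b\<^sub>M A \<longrightarrow>
        measure_pmf.prob (run N k F C A)
          {(K, m, m'). \<exists>i\<in>{1..N} - C. Ver N k \<omega> s K i 0 m'} \<le> \<epsilon>_for)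
     \<and>
      (\<forall>C (A :: 'r coalition). C \<subseteq> {1..N} \<and> card C = \<omega> \<and> forger b\<^sub>M A \<longrightarrow>
        (let p = measure_pmf.prob (run N k F C A) {(K, m, m'). MV N (vote N k \<omega> s C K m')} in
           p \<le> q_attack \<and>
           (own_tests_pass N k s F C A \<and> optimal_guesses N k b\<^sub>H F C A \<longrightarrow>
              p = q_attack \<and> p \<ge> p_attack \<and>
              (\<lfloor>real k * (1 - s (-1))\<rfloor> = \<lfloor>real k * (1 - s 0)\<rfloor> \<longrightarrow> p = p_attack))))
     \<and>
     (\<forall>C d d'. C \<subseteq> {1..N} \<and> card C = \<omega> \<and> d \<in> bitstrings b\<^sub>M \<and> d' \<in> bitstrings b\<^sub>M \<and> d \<noteq> d' \<and>
        bound_attained b\<^sub>H F d d' \<longrightarrow>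
        (\<exists>A :: 'r coalition. forger b\<^sub>M A \<and> own_tests_pass N k s F C A \<and> optimal_guesses N k b\<^sub>H F C A))"
proof -
  \<comment> \<open>Summing the positive spacings carries positivity from the last threshold up to
    \<open>s 0\<close>.\<close>
  have s_le: "s (int l) \<le> s 0" if "l \<le> l_max" for l
    using that
  proof (induction l)
    case (Suc l)
    have "s (int (Suc l) - 1) - s (int (Suc l)) = \<Delta>s" using Suc.prems by (intro bspec[OF assms(9)]) auto
    thus ?case using Suc assms(8) by simp
  qed simp
  have "s (0 - 1) - s 0 = \<Delta>s" by (intro bspec[OF assms(9)]) auto
  hence s: "0 < s 0" "s 0 < s (-1)" "s (-1) < 1 / 2"
    using s_le[of l_max] assms(6,7,8) by simp_all
  have N: "2 * \<omega> \<le> N" using assms(4) by simp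
  have p: "(2 :: real) powi (1 - int b\<^sub>H) \<in> {0..1}"
    using power_int_increasing[of "1 - int b\<^sub>H" 0 "2 :: real"] assms(3) by simp
  have attack_le: "p_attack \<le> q_attack"
  proof -
    \<comment> \<open>The laxer threshold lowers the starting index of the tail;
      \<open>Xi_mono\<close> passes the gain on to the verdicts and then to the vote.\<close>
    have "real k * (1 - s (-1)) \<le> real k * (1 - s 0)" using s by (intro mult_left_mono) auto
    hence "nat \<lfloor>real k * (1 - s (-1))\<rfloor> + 1 \<le> nat \<lfloor>real k * (1 - s 0)\<rfloor> + 1"
      by (intro add_right_mono nat_mono floor_mono)
    hence "p_t \<le> q_t" unfolding p_t_def q_t_def by (rule Xi_antimono[OF p])
    moreover have "p_t \<in> {0..1}" "q_t \<in> {0..1}" unfolding p_t_def q_t_def by (intro Xi_in_unit p)+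
    ultimately have "p_m1 \<le> q_m1" unfolding p_m1_def q_m1_def by (intro Xi_mono) auto
    moreover have "p_m1 \<in> {0..1}" "q_m1 \<in> {0..1}"
      unfolding p_m1_def q_m1_def by (intro Xi_in_unit \<open>p_t \<in> {0..1}\<close> \<open>q_t \<in> {0..1}\<close>)+
    ultimately show ?thesis unfolding p_attack_def q_attack_def by (intro Xi_mono) auto
  qed
  have attack_eq: "p_attack = q_attack" if "\<lfloor>real k * (1 - s (-1))\<rfloor> = \<lfloor>real k * (1 - s 0)\<rfloor>"
    unfolding p_attack_def q_attack_def p_m1_def q_m1_def p_t_def q_t_def that ..
  show ?thesis
  proof (intro conjI allI impI)
    fix C and A :: "'r coalition"
    assume "C \<subseteq> {1..N} \<and> card C \<le> \<omega> \<and> forger b\<^sub>M A"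
    thus "measure_pmf.prob (run N k F C A) {(K, m, m'). \<exists>i\<in>{1..N} - C. Ver N k \<omega> s K i 0 m'} \<le> \<epsilon>_for"
      unfolding \<epsilon>_for_def p_t_def using s
      by (intro forgery_bound[OF assms(10,3) _ _ _ assms(1,2) N]) auto
  next
    fix C and A :: "'r coalition"
    assume CA: "C \<subseteq> {1..N} \<and> card C = \<omega> \<and> forger b\<^sub>M A"
    have "0 < s (-1)" "s (-1) < 1" using s by auto
    note attack = majority_vote_attack[where s = s, OF assms(10,3) conjunct1[OF CA] conjunct1[OF conjunct2[OF CA]]
        conjunct2[OF conjunct2[OF CA]] assms(1) this, of k, folded q_t_def, folded q_m1_def, folded q_attack_def]
    show "let p = measure_pmf.prob (run N k F C A) {(K, m, m'). MV N (vote N k \<omega> s C K m')} in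
           p \<le> q_attack \<and>
           (own_tests_pass N k s F C A \<and> optimal_guesses N k b\<^sub>H F C A \<longrightarrow>
              p = q_attack \<and> p \<ge> p_attack \<and>
              (\<lfloor>real k * (1 - s (-1))\<rfloor> = \<lfloor>real k * (1 - s 0)\<rfloor> \<longrightarrow> p = p_attack))"
      unfolding Let_def
      by (intro conjI impI attack(1); elim conjE) (simp_all only: attack(2) attack_le attack_eq)
  next
    fix C d d'
    assume "C \<subseteq> {1..N} \<and> card C = \<omega> \<and> d \<in> bitstrings b\<^sub>M \<and> d' \<in> bitstrings b\<^sub>M \<and> d \<noteq> d' \<and>
        bound_attained b\<^sub>H F d d'"
    thus "\<exists>A :: 'r coalition. forger b\<^sub>M A \<and> own_tests_pass N k s F C A \<and> optimal_guesses N k b\<^sub>H F C A"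
      using s by (intro optimal_coalition_exists[where d = d and d' = d', OF assms(10) _ assms(2)]) auto
  qed
qed

end
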